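(* (1) Let $\mathcal A\subset V^*$ be a $\vee$-system and let $\mathfrak g_{\Delta}$ be the holonomy Lie algebra of the associated arrangement $\Delta=\bigcup_{\alpha\in\mathcal A}\{\alpha=0\}\subset V$. Then the formula $$\rho(t_\alpha)=\alpha^\vee\otimes\alpha,\qquad \alpha\in\mathcal A,$$ defines a representation $\rho:\mathfrak g_{\Delta}\to \mathrm{End}(V)$. (2) Let $(V,G)$ be a complex Euclidean space, let $\mathcal A$ be a complex Euclidean $\vee$-system in $V\cong V^*$, and let $\Delta$ be the associated arrangement. Then the formula $$\rho(t_\alpha)=\hat\alpha\otimes\alpha,\qquad \alpha\in\mathcal A,$$ defines a representation $\rho:\mathfrak g_{\Delta}\to \mathrm{End}(V)$. (3) Conversely, let $(V,G)$ be a complex Euclidean space, let $\Delta$ be an irreducible central hyperplane arrangement in $V$, and let $\mathcal A\subset V^*$ be an equipment of $\Delta$. If $\rho(t_\alpha)=\hat\alpha\otimes\alpha$, $\alpha\in\mathcal A$, defines a representation of $\mathfrak g_{\Delta}$ in $V$, then $\mathcal A$ is a complex Euclidean $\vee$-system.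
   Context: $V$ is a finite-dimensional complex vector space and $\mathcal A\subset V^*$ is a finite set of pairwise non-collinear covectors. For $v\in V$, $\alpha\in V^*$, $v\otimes\alpha$ denotes the operator $x\mapsto \alpha(x)v$ on $V$. The canonical form of a finite set $\mathcal A$ of covectors is $G_{\mathcal A}(x,y)=\sum_{\alpha\in\mathcal A}\alpha(x)\alpha(y)$. **$\vee$-systems.** Suppose $\mathcal A$ spans $V^*$ and the canonical form $G_{\mathcal A}$ on $V$ is non-degenerate. It gives an isomorphism $\varphi_{\mathcal A}:V\to V^*$, and $\alpha^\vee=\varphi_{\mathcal A}^{-1}(\alpha)$. The set $\mathcal A$ is a $\vee$-system if for every $\alpha\in\mathcal A$ and every two-dimensional plane $\Pi\subset V^*$ containing $\alpha$ one has $\sum_{\beta\in\Pi\cap\mathcal A}\beta(\alpha^\vee)\beta^\vee=\nu\alpha^\vee$ for some $\nu$, which may depend on $\Pi$ and $\alpha$. **Complex Euclidean $\vee$-systems.** A complex Euclidean space is a complex vector space $V$ with a non-degenerate symmetric bilinear form $G$; for $\alpha\in V^*$, $\hat\alpha=G^{-1}\alpha\in V$ is the vector with $G(\hat\alpha,x)=\alpha(x)$ for all $x\in V$. $V$ and $V^*$ are identified via $G$. A finite set $\mathcal A$ of non-collinear vectors in $V\cong V^*$ is well-distributed in $V$ if its canonical form $G_{\mathcal A}$ is proportional to the Euclidean form $G$ (the canonical form is allowed to be zero). $\mathcal A$ is a complex Euclidean $\vee$-system if it is well-distributed in $V$ and any two-dimensional subsystem of it (its intersection with a two-dimensional plane)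 is either reducible (consists of two orthogonal vectors) or well-distributed in the corresponding plane, i.e. the canonical form of the subsystem on that plane is proportional to the Euclidean form on that plane. **Arrangements.** An equipment of a central hyperplane arrangement $\Delta$ in $V$ is a set $\mathcal A=\{\alpha_H: H\in\Delta\}\subset V^*$ with $H=\{x\in V:\alpha_H(x)=0\}$ for each $H\in\Delta$; it is assumed that $\mathcal A$ generates $V^*$. $\Delta$ is irreducible if there is no decomposition $V^*=V_1\oplus V_2$ into nonzero subspaces such that $\mathcal A=(\mathcal A\cap V_1)\cup(\mathcal A\cap V_2)$. **Holonomy Lie algebra.** $\mathfrak g_{\Delta}$ is the Lie algebra with generators $t_\alpha$, $\alpha\in\mathcal A$, and relations $[t_\alpha,\sum_{\beta\in\mathcal A\cap\Pi}t_\beta]=0$ for every two-dimensional subspace $\Pi\subset V^*$ and every $\alpha\in\mathcal A\cap\Pi$.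
   Formalization: Well-distributed in a plane is read as G_B(x,y) = νG(x,y) for x in the plane and all y in V, not only y in the plane; this differs only where G degenerates on the plane, and there the literal part (2) is false. *)

theory Defs
  imports Complex_Main "HOL-Library.Function_Algebras"
begin

record 'l lie_structure =
  lie_carrier :: "'l set"
  lie_zero :: 'l
  lie_add :: "'l \<Rightarrow> 'l \<Rightarrow> 'l"
  lie_smult :: "complex \<Rightarrow> 'l \<Rightarrow> 'l"
  lie_bracket :: "'l \<Rightarrow> 'l \<Rightarrow> 'l"

locale complex_lie_algebra =
  fixes L :: "'l lie_structure"
  assumes zero_closed: "lie_zero L \<in> lie_carrier L"
    and add_closed: "\<lbrakk>x \<in> lie_carrier L; y \<in> lie_carrier L\<rbrakk> \<Longrightarrow> lie_add L x y \<in> lie_carrier L"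
    and smult_closed: "x \<in> lie_carrier L \<Longrightarrow> lie_smult L c x \<in> lie_carrier L"
    and bracket_closed:
      "\<lbrakk>x \<in> lie_carrier L; y \<in> lie_carrier L\<rbrakk> \<Longrightarrow> lie_bracket L x y \<in> lie_carrier L"
    and add_assoc: "\<lbrakk>x \<in> lie_carrier L; y \<in> lie_carrier L; z \<in> lie_carrier L\<rbrakk> \<Longrightarrow>
      lie_add L (lie_add L x y) z = lie_add L x (lie_add L y z)"
    and add_commute: "\<lbrakk>x \<in> lie_carrier L; y \<in> lie_carrier L\<rbrakk> \<Longrightarrow> lie_add L x y = lie_add L y x"
    and add_zero: "x \<in> lie_carrier L \<Longrightarrow> lie_add L (lie_zero L) x = x"
    and smult_add: "\<lbrakk>x \<in> lie_carrier L; y \<in> lie_carrier L\<rbrakk> \<Longrightarrow>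
      lie_smult L c (lie_add L x y) = lie_add L (lie_smult L c x) (lie_smult L c y)"
    and add_smult: "x \<in> lie_carrier L \<Longrightarrow>
      lie_smult L (c + d) x = lie_add L (lie_smult L c x) (lie_smult L d x)"
    and smult_smult: "x \<in> lie_carrier L \<Longrightarrow>
      lie_smult L c (lie_smult L d x) = lie_smult L (c * d) x"
    and smult_one: "x \<in> lie_carrier L \<Longrightarrow> lie_smult L 1 x = x"
    and smult_zero: "x \<in> lie_carrier L \<Longrightarrow> lie_smult L 0 x = lie_zero L"
    and bracket_add: "\<lbrakk>x \<in> lie_carrier L; y \<in> lie_carrier L; z \<in> lie_carrier L\<rbrakk> \<Longrightarrow>
      lie_bracket L (lie_add L x y) z = lie_add L (lie_bracket L x z) (lie_bracket L y z)"
    and bracket_smult: "\<lbrakk>x \<in> lie_carrier L; y \<in> lie_carrier L\<rbrakk> \<Longrightarrow>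
      lie_bracket L (lie_smult L c x) y = lie_smult L c (lie_bracket L x y)"
    and add_bracket: "\<lbrakk>x \<in> lie_carrier L; y \<in> lie_carrier L; z \<in> lie_carrier L\<rbrakk> \<Longrightarrow>
      lie_bracket L z (lie_add L x y) = lie_add L (lie_bracket L z x) (lie_bracket L z y)"
    and smult_bracket: "\<lbrakk>x \<in> lie_carrier L; y \<in> lie_carrier L\<rbrakk> \<Longrightarrow>
      lie_bracket L y (lie_smult L c x) = lie_smult L c (lie_bracket L y x)"
    and bracket_self: "x \<in> lie_carrier L \<Longrightarrow> lie_bracket L x x = lie_zero L"
    and jacobi: "\<lbrakk>x \<in> lie_carrier L; y \<in> lie_carrier L; z \<in> lie_carrier L\<rbrakk> \<Longrightarrow>
      lie_add L (lie_bracket L x (lie_bracket L y z))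
        (lie_add L (lie_bracket L y (lie_bracket L z x)) (lie_bracket L z (lie_bracket L x y)))
      = lie_zero L"

definition lie_hom :: "'l lie_structure \<Rightarrow> 'm lie_structure \<Rightarrow> ('l \<Rightarrow> 'm) \<Rightarrow> bool" where
  "lie_hom L M \<phi> \<longleftrightarrow>
     (\<forall>x\<in>lie_carrier L. \<phi> x \<in> lie_carrier M) \<and>
     (\<forall>x\<in>lie_carrier L. \<forall>y\<in>lie_carrier L. \<phi> (lie_add L x y) = lie_add M (\<phi> x) (\<phi> y)) \<and>
     (\<forall>c. \<forall>x\<in>lie_carrier L. \<phi> (lie_smult L c x) = lie_smult M c (\<phi> x)) \<and>
     (\<forall>x\<in>lie_carrier L. \<forall>y\<in>lie_carrier L.
        \<phi> (lie_bracket L x y) = lie_bracket M (\<phi> x) (\<phi> y))"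

datatype (lie_gens: 'g) lie_term =
    Gen 'g
  | Zero
  | Add "'g lie_term" "'g lie_term"
  | Smult complex "'g lie_term"
  | Bracket "'g lie_term" "'g lie_term"

definition lie_terms :: "'g set \<Rightarrow> 'g lie_term set" where
  "lie_terms X = {t. lie_gens t \<subseteq> X}"

text \<open>The least congruence on the terms over \<open>X\<close> that contains the axioms of a complex Lie
  algebra and identifies every term of \<open>R\<close> with zero.\<close>

inductive lie_cong :: "'g set \<Rightarrow> 'g lie_term set \<Rightarrow> 'g lie_term \<Rightarrow> 'g lie_term \<Rightarrow> bool"
  for X :: "'g set" and R :: "'g lie_term set" where
  refl: "s \<in> lie_terms X \<Longrightarrow> lie_cong X R s s"
| sym: "lie_cong X R s t \<Longrightarrow> lie_cong X R t s"
| trans: "lie_cong X R s t \<Longrightarrow> lie_cong X R t u \<Longrightarrow> lie_cong X R s u"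
| Add_cong: "lie_cong X R s s' \<Longrightarrow> lie_cong X R t t' \<Longrightarrow> lie_cong X R (Add s t) (Add s' t')"
| Smult_cong: "lie_cong X R s s' \<Longrightarrow> lie_cong X R (Smult c s) (Smult c s')"
| Bracket_cong:
    "lie_cong X R s s' \<Longrightarrow> lie_cong X R t t' \<Longrightarrow> lie_cong X R (Bracket s t) (Bracket s' t')"
| Add_assoc: "\<lbrakk>s \<in> lie_terms X; t \<in> lie_terms X; u \<in> lie_terms X\<rbrakk> \<Longrightarrow>
    lie_cong X R (Add (Add s t) u) (Add s (Add t u))"
| Add_commute: "\<lbrakk>s \<in> lie_terms X; t \<in> lie_terms X\<rbrakk> \<Longrightarrow> lie_cong X R (Add s t) (Add t s)"
| Add_Zero: "s \<in> lie_terms X \<Longrightarrow> lie_cong X R (Add Zero s) s"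
| Smult_Add: "\<lbrakk>s \<in> lie_terms X; t \<in> lie_terms X\<rbrakk> \<Longrightarrow>
    lie_cong X R (Smult c (Add s t)) (Add (Smult c s) (Smult c t))"
| Add_Smult: "s \<in> lie_terms X \<Longrightarrow>
    lie_cong X R (Smult (c + d) s) (Add (Smult c s) (Smult d s))"
| Smult_Smult: "s \<in> lie_terms X \<Longrightarrow> lie_cong X R (Smult c (Smult d s)) (Smult (c * d) s)"
| Smult_one: "s \<in> lie_terms X \<Longrightarrow> lie_cong X R (Smult 1 s) s"
| Smult_zero: "s \<in> lie_terms X \<Longrightarrow> lie_cong X R (Smult 0 s) Zero"
| Bracket_Add: "\<lbrakk>s \<in> lie_terms X; t \<in> lie_terms X; u \<in> lie_terms X\<rbrakk> \<Longrightarrow>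
    lie_cong X R (Bracket (Add s t) u) (Add (Bracket s u) (Bracket t u))"
| Bracket_Smult: "\<lbrakk>s \<in> lie_terms X; t \<in> lie_terms X\<rbrakk> \<Longrightarrow>
    lie_cong X R (Bracket (Smult c s) t) (Smult c (Bracket s t))"
| Add_Bracket: "\<lbrakk>s \<in> lie_terms X; t \<in> lie_terms X; u \<in> lie_terms X\<rbrakk> \<Longrightarrow>
    lie_cong X R (Bracket u (Add s t)) (Add (Bracket u s) (Bracket u t))"
| Smult_Bracket: "\<lbrakk>s \<in> lie_terms X; t \<in> lie_terms X\<rbrakk> \<Longrightarrow>
    lie_cong X R (Bracket t (Smult c s)) (Smult c (Bracket t s))"
| Bracket_self: "s \<in> lie_terms X \<Longrightarrow> lie_cong X R (Bracket s s) Zero"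
| Jacobi: "\<lbrakk>s \<in> lie_terms X; t \<in> lie_terms X; u \<in> lie_terms X\<rbrakk> \<Longrightarrow>
    lie_cong X R
      (Add (Bracket s (Bracket t u)) (Add (Bracket t (Bracket u s)) (Bracket u (Bracket s t)))) Zero"
| relation: "\<lbrakk>r \<in> R; r \<in> lie_terms X\<rbrakk> \<Longrightarrow> lie_cong X R r Zero"

definition lie_class :: "'g set \<Rightarrow> 'g lie_term set \<Rightarrow> 'g lie_term \<Rightarrow> 'g lie_term set" where
  "lie_class X R t = {s. lie_cong X R t s}"

definition presented_lie :: "'g set \<Rightarrow> 'g lie_term set \<Rightarrow> 'g lie_term set lie_structure" where
  "presented_lie X R = \<lparr>
     lie_carrier = lie_class X R ` lie_terms X,
     lie_zero = lie_class X R Zero,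
     lie_add = (\<lambda>P Q. \<Union>s\<in>P. \<Union>t\<in>Q. lie_class X R (Add s t)),
     lie_smult = (\<lambda>c P. \<Union>s\<in>P. lie_class X R (Smult c s)),
     lie_bracket = (\<lambda>P Q. \<Union>s\<in>P. \<Union>t\<in>Q. lie_class X R (Bracket s t))\<rparr>"

lemma lie_terms_simps [simp]:
  "Gen a \<in> lie_terms X \<longleftrightarrow> a \<in> X"
  "Zero \<in> lie_terms X"
  "Add s t \<in> lie_terms X \<longleftrightarrow> s \<in> lie_terms X \<and> t \<in> lie_terms X"
  "Smult c s \<in> lie_terms X \<longleftrightarrow> s \<in> lie_terms X"
  "Bracket s t \<in> lie_terms X \<longleftrightarrow> s \<in> lie_terms X \<and> t \<in> lie_terms X"
  by (auto simp: lie_terms_def)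

lemma lie_class_eqI: "lie_cong X R s t \<Longrightarrow> lie_class X R s = lie_class X R t"
  by (auto simp: lie_class_def intro: lie_cong.sym lie_cong.trans)

lemma lie_class_eq_iff:
  assumes "t \<in> lie_terms X"
  shows "lie_class X R s = lie_class X R t \<longleftrightarrow> lie_cong X R s t"
  using assms lie_class_eqI[of X R s t] lie_cong.refl[of t X R]
  by (auto simp: lie_class_def)

lemma presented_lie_ops:
  assumes "s \<in> lie_terms X" "t \<in> lie_terms X"
  shows "lie_add (presented_lie X R) (lie_class X R s) (lie_class X R t) = lie_class X R (Add s t)"
    and "lie_smult (presented_lie X R) c (lie_class X R s) = lie_class X R (Smult c s)"
    and "lie_bracket (presented_lie X R) (lie_class X R s) (lie_class X R t)
           = lie_class X R (Bracket s t)"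
proof -
  have s: "s \<in> lie_class X R s" and t: "t \<in> lie_class X R t"
    using assms by (auto simp: lie_class_def intro: lie_cong.refl)
  have UN_const: "(\<Union>p\<in>P. f p) = c"
    if "q \<in> P" "\<And>p. p \<in> P \<Longrightarrow> f p = c" for P f c and q :: "'a lie_term"
    using that by (metis (no_types, lifting) SUP_cong UN_constant empty_iff)
  have A: "lie_class X R (Add s' t') = lie_class X R (Add s t)"
    and B: "lie_class X R (Bracket s' t') = lie_class X R (Bracket s t)"
    and S: "lie_class X R (Smult c s') = lie_class X R (Smult c s)"
    if "s' \<in> lie_class X R s" "t' \<in> lie_class X R t" for s' t'
  proof -
    have "lie_cong X R s' s" "lie_cong X R t' t"
      using that by (auto simp: lie_class_def intro: lie_cong.sym)
    then show "lie_class X R (Add s' t') = lie_class X R (Add s t)"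
      "lie_class X R (Bracket s' t') = lie_class X R (Bracket s t)"
      "lie_class X R (Smult c s') = lie_class X R (Smult c s)"
      by (simp_all add: lie_class_eqI lie_cong.Add_cong lie_cong.Bracket_cong lie_cong.Smult_cong)
  qed
  show "lie_add (presented_lie X R) (lie_class X R s) (lie_class X R t) = lie_class X R (Add s t)"
    unfolding presented_lie_def lie_structure.simps by (intro UN_const[OF s] UN_const[OF t] A)
  show "lie_bracket (presented_lie X R) (lie_class X R s) (lie_class X R t)
      = lie_class X R (Bracket s t)"
    unfolding presented_lie_def lie_structure.simps by (intro UN_const[OF s] UN_const[OF t] B)
  show "lie_smult (presented_lie X R) c (lie_class X R s) = lie_class X R (Smult c s)"
    unfolding presented_lie_def lie_structure.simps by (intro UN_const[OF s] S[OF _ t])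
qed

lemma presented_lie_carrier: "lie_carrier (presented_lie X R) = lie_class X R ` lie_terms X"
  and presented_lie_zero: "lie_zero (presented_lie X R) = lie_class X R Zero"
  by (simp_all add: presented_lie_def)

lemma complex_lie_algebra_presented: "complex_lie_algebra (presented_lie X R)"
proof -
  note smult = presented_lie_ops(2)[where t = Zero, OF _ lie_terms_simps(2)]
  show ?thesis
    by (unfold_locales; unfold presented_lie_carrier presented_lie_zero)
      (((elim imageE)?, (simp only: presented_lie_ops(1,3) smult lie_terms_simps)?,
      (rule imageI | (rule lie_class_eqI, rule lie_cong.intros(7-)))); simp; fail)+
qed

lemma lie_hom_presented_unique:
  assumes M: "complex_lie_algebra M"
    and \<phi>: "lie_hom (presented_lie X R) M \<phi>" and \<psi>: "lie_hom (presented_lie X R) M \<psi>"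
    and gen: "\<And>a. a \<in> X \<Longrightarrow> \<phi> (lie_class X R (Gen a)) = \<psi> (lie_class X R (Gen a))"
    and x: "x \<in> lie_carrier (presented_lie X R)"
  shows "\<phi> x = \<psi> x"
proof -
  let ?L = "presented_lie X R"
  have ops: "\<chi> (lie_class X R (Add s t)) =
        lie_add M (\<chi> (lie_class X R s)) (\<chi> (lie_class X R t))"
      "\<chi> (lie_class X R (Smult c s)) = lie_smult M c (\<chi> (lie_class X R s))"
      "\<chi> (lie_class X R (Bracket s t)) =
        lie_bracket M (\<chi> (lie_class X R s)) (\<chi> (lie_class X R t))"
      "\<chi> (lie_class X R s) \<in> lie_carrier M"
    if "lie_hom ?L M \<chi>" "s \<in> lie_terms X" "t \<in> lie_terms X" for \<chi> s t c
    using that by (auto simp: lie_hom_def presented_lie_carrier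
        simp flip: presented_lie_ops[where X = X and R = R])
  have Z: "lie_class X R Zero = lie_class X R (Smult 0 Zero)"
    by (intro lie_class_eqI lie_cong.sym[OF lie_cong.Smult_zero]) simp
  have M0: "\<chi> (lie_class X R Zero) = lie_zero M" if "lie_hom ?L M \<chi>" for \<chi>
    using ops(2)[OF that, of Zero Zero 0] ops(4)[OF that, of Zero Zero] Z
      complex_lie_algebra.smult_zero[OF M] by simp
  have "\<phi> (lie_class X R t) = \<psi> (lie_class X R t)" if "t \<in> lie_terms X" for t
    using that by (induction t) (simp_all add: gen ops[OF \<phi>] ops[OF \<psi>] M0[OF \<phi>] M0[OF \<psi>])
  with x show ?thesis by (auto simp: presented_lie_carrier)
qed

text \<open>The vector space is the type \<open>'v\<close> with scalar multiplication \<open>sc\<close>; its dual consists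
  of the linear functions \<open>'v \<Rightarrow> complex\<close> with pointwise operations.\<close>

definition fscale :: "complex \<Rightarrow> ('v \<Rightarrow> complex) \<Rightarrow> 'v \<Rightarrow> complex" where
  "fscale c f = (\<lambda>x. c * f x)"

interpretation covec: vector_space fscale
  by unfold_locales (auto simp: fscale_def fun_eq_iff algebra_simps)

definition dual :: "(complex \<Rightarrow> 'v::ab_group_add \<Rightarrow> 'v) \<Rightarrow> ('v \<Rightarrow> complex) set" where
  "dual sc = {f. Vector_Spaces.linear sc (*) f}"

definition pairwise_noncollinear :: "('v \<Rightarrow> complex) set \<Rightarrow> bool" where
  "pairwise_noncollinear A \<longleftrightarrow> pairwise (\<lambda>\<alpha> \<beta>. covec.independent {\<alpha>, \<beta>}) A"

definition covector_plane ::
    "(complex \<Rightarrow> 'v::ab_group_add \<Rightarrow> 'v) \<Rightarrow> ('v \<Rightarrow> complex) set \<Rightarrow> bool" where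
  "covector_plane sc \<Pi> \<longleftrightarrow> covec.subspace \<Pi> \<and> \<Pi> \<subseteq> dual sc \<and> covec.dim \<Pi> = 2"

definition rank_one :: "(complex \<Rightarrow> 'v \<Rightarrow> 'v) \<Rightarrow> 'v \<Rightarrow> ('v \<Rightarrow> complex) \<Rightarrow> 'v \<Rightarrow> 'v" where
  "rank_one sc v \<alpha> = (\<lambda>x. sc (\<alpha> x) v)"

definition canonical_form :: "('v \<Rightarrow> complex) set \<Rightarrow> 'v \<Rightarrow> 'v \<Rightarrow> complex" where
  "canonical_form A x y = (\<Sum>\<alpha>\<in>A. \<alpha> x * \<alpha> y)"

definition nondegenerate :: "('v::zero \<Rightarrow> 'v \<Rightarrow> complex) \<Rightarrow> bool" where
  "nondegenerate G \<longleftrightarrow> (\<forall>x. (\<forall>y. G x y = 0) \<longrightarrow> x = 0)"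

text \<open>The vector representing \<open>\<alpha>\<close> with respect to \<open>G\<close>; meaningful for non-degenerate \<open>G\<close> on a
  finite-dimensional space.\<close>

definition sharp :: "('v \<Rightarrow> 'v \<Rightarrow> complex) \<Rightarrow> ('v \<Rightarrow> complex) \<Rightarrow> 'v" where
  "sharp G \<alpha> = (THE v. \<forall>x. G v x = \<alpha> x)"

definition complex_euclidean ::
    "(complex \<Rightarrow> 'v::ab_group_add \<Rightarrow> 'v) \<Rightarrow> ('v \<Rightarrow> 'v \<Rightarrow> complex) \<Rightarrow> bool" where
  "complex_euclidean sc G \<longleftrightarrow>
     (\<forall>x. G x \<in> dual sc) \<and> (\<forall>x y. G x y = G y x) \<and> nondegenerate G"

definition vee_system ::
    "(complex \<Rightarrow> 'v::ab_group_add \<Rightarrow> 'v) \<Rightarrow> ('v \<Rightarrow> complex) set \<Rightarrow> bool" where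
  "vee_system sc A \<longleftrightarrow>
     finite A \<and> A \<subseteq> dual sc \<and> pairwise_noncollinear A \<and>
     covec.span A = dual sc \<and> nondegenerate (canonical_form A) \<and>
     (\<forall>\<alpha>\<in>A. \<forall>\<Pi>. covector_plane sc \<Pi> \<and> \<alpha> \<in> \<Pi> \<longrightarrow>
        (\<exists>\<nu>. (\<Sum>\<beta>\<in>\<Pi> \<inter> A. sc (\<beta> (sharp (canonical_form A) \<alpha>)) (sharp (canonical_form A) \<beta>))
             = sc \<nu> (sharp (canonical_form A) \<alpha>)))"

text \<open>Proportionality of the canonical form of \<open>B\<close> to \<open>G\<close> on a subspace \<open>W\<close>, where \<open>W\<close> is the
  subspace identified with a space of covectors containing \<open>B\<close>.  For such \<open>B\<close>, if the restriction
  of \<open>G\<close> to \<open>W\<close> is non-degenerate, it makes no difference whether \<open>y\<close> ranges over \<open>W\<close> or over the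
  whole space (lemma \<open>well_distributed_iff_restricted\<close> below).  The complex Euclidean form may
  however degenerate on \<open>W\<close>.  Then the forms restricted to \<open>W\<close> in both arguments lose
  information: if \<open>G\<close> has rank one on a plane \<open>W\<close>, they are proportional for every \<open>B\<close>.
  Proportionality is therefore required of the two maps from \<open>W\<close> to the dual of the whole space,
  i.e. \<open>x \<mapsto> \<Sum>\<beta>\<in>B. \<beta> x \<beta>\<close> is a multiple of the identification of \<open>W\<close> with covectors.\<close>

definition well_distributed ::
    "('v \<Rightarrow> 'v \<Rightarrow> complex) \<Rightarrow> 'v set \<Rightarrow> ('v \<Rightarrow> complex) set \<Rightarrow> bool" where
  "well_distributed G W B \<longleftrightarrow> (\<exists>\<nu>. \<forall>x\<in>W. \<forall>y. canonical_form B x y = \<nu> * G x y)"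

lemma mem_dual:
  assumes "f \<in> dual sc"
  shows "f (x + y) = f x + f y" "f (sc c x) = c * f x" "f 0 = 0" "f (x - y) = f x - f y"
    "f (sum h B) = (\<Sum>b\<in>B. f (h b))"
proof -
  interpret Vector_Spaces.linear sc "(*)" f using assms by (simp add: dual_def)
  show "f (x + y) = f x + f y" "f (sc c x) = c * f x" "f 0 = 0" "f (x - y) = f x - f y"
    "f (sum h B) = (\<Sum>b\<in>B. f (h b))"
    by (simp_all add: add scale diff sum)
qed

lemma dual_iff:
  assumes "vector_space sc"
  shows "f \<in> dual sc \<longleftrightarrow> (\<forall>x y. f (x + y) = f x + f y) \<and> (\<forall>c x. f (sc c x) = c * f x)"
proof -
  have "vector_space ((*) :: complex \<Rightarrow> complex \<Rightarrow> complex)"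
    by unfold_locales (auto simp: algebra_simps)
  with assms show ?thesis
    by (auto simp: dual_def Vector_Spaces.linear_def module_hom_def module_hom_axioms_def
        module_iff_vector_space)
qed

lemma subspace_dual:
  assumes "vector_space sc"
  shows "covec.subspace (dual sc)"
  unfolding covec.subspace_def
  by (auto simp: dual_iff[OF assms] fscale_def algebra_simps)

lemma sharp_eqI:
  assumes "complex_euclidean sc G" "\<And>x. G v x = \<alpha> x"
  shows "sharp G \<alpha> = v"
  unfolding sharp_def
proof (rule the_equality)
  fix w assume w: "\<forall>x. G w x = \<alpha> x"
  have G: "G x \<in> dual sc" "G y x = G x y" for x y
    using assms(1) unfolding complex_euclidean_def by blast+
  have "G (w - v) x = 0" for x
  proof -
    have "G (w - v) x = G w x - G v x"
      using mem_dual(4)[OF G(1), of x w v] by (simp only: G(2)[of _ x])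
    then show ?thesis using w assms(2) by simp
  qed
  then have "w - v = 0"
    using assms(1) unfolding complex_euclidean_def nondegenerate_def by blast
  then show "w = v" by simp
qed (use assms(2) in simp)

lemma sharp_eq:
  assumes fd: "finite_dimensional_vector_space sc basis"
    and G: "complex_euclidean sc G" and \<alpha>: "\<alpha> \<in> dual sc"
  shows "G (sharp G \<alpha>) x = \<alpha> x"
proof -
  interpret V: finite_dimensional_vector_space sc basis by fact
  have vs: "vector_space ((*) :: complex \<Rightarrow> complex \<Rightarrow> complex)"
    by unfold_locales (auto simp: algebra_simps)
  define E where "E v = (\<Sum>b\<in>basis. sc (G v b) b)" for v
  define a where "a = (\<Sum>b\<in>basis. sc (\<alpha> b) b)"
  have Gd: "G v \<in> dual sc" "G v w = G w v" for v w
    using G by (auto simp: complex_euclidean_def)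
  have Gl: "G (v + w) b = G v b + G w b" "G (sc c v) b = c * G v b" for v w b c
    using mem_dual(1,2)[OF Gd(1)[of b]] Gd(2) by metis+
  have linE: "Vector_Spaces.linear sc sc E"
    by unfold_locales
      (auto simp: E_def Gl V.scale_left_distrib V.scale_sum_right sum.distrib)
  have coeff: "f b = g b" if "(\<Sum>b\<in>basis. sc (f b) b) = (\<Sum>b\<in>basis. sc (g b) b)" "b \<in> basis"
    for f g b
  proof -
    have "(\<Sum>b\<in>basis. sc (f b - g b) b) = 0"
      using that(1) by (simp add: V.scale_left_diff_distrib sum_subtractf)
    then show ?thesis
      using V.independentD[OF V.independent_Basis V.finite_Basis order_refl, of "\<lambda>b. f b - g b" b]
        that(2) by simp
  qed
  have ext: "f = g" if "f \<in> dual sc" "g \<in> dual sc" "\<And>b. b \<in> basis \<Longrightarrow> f b = g b" for f g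
  proof
    fix x
    have "x \<in> V.span basis" by (simp add: V.span_Basis)
    then obtain u where "x = (\<Sum>b\<in>basis. sc (u b) b)"
      using V.span_finite[OF V.finite_Basis] by auto
    then show "f x = g x"
      using that by (simp add: mem_dual)
  qed
  have inj: "inj E"
  proof (rule injI)
    fix v w assume "E v = E w"
    then have "G v b = G w b" if "b \<in> basis" for b
      using coeff[of "G v" "G w" b] that by (simp add: E_def)
    then have "G v = G w" by (intro ext Gd) auto
    then have "sharp G (G v) = w" "sharp G (G v) = v" by (auto intro!: sharp_eqI[OF G])
    then show "v = w" by simp
  qed
  then have "surj E"
    using V.linear_inj_imp_surj[OF linE] by simp
  then obtain v where "E v = a" by (metis surjD)
  then have "G v b = \<alpha> b" if "b \<in> basis" for b
    using coeff[of "G v" \<alpha> b] that by (simp add: E_def a_def)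
  then have "G v = \<alpha>" by (intro ext Gd \<alpha>) auto
  then have "sharp G \<alpha> = v" by (auto intro!: sharp_eqI[OF G])
  with \<open>G v = \<alpha>\<close> show ?thesis by simp
qed

lemma well_distributed_iff_restricted:
  assumes fd: "finite_dimensional_vector_space sc basis" and G: "complex_euclidean sc G"
    and \<Pi>: "covec.subspace \<Pi>" "\<Pi> \<subseteq> dual sc" and B: "B \<subseteq> \<Pi>"
    and W: "W = sharp G ` \<Pi>"
    and nondeg: "\<forall>x\<in>W. (\<forall>y\<in>W. G x y = 0) \<longrightarrow> x = 0"
  shows "well_distributed G W B \<longleftrightarrow> (\<exists>\<nu>. \<forall>x\<in>W. \<forall>y\<in>W. canonical_form B x y = \<nu> * G x y)"
proof
  assume "\<exists>\<nu>. \<forall>x\<in>W. \<forall>y\<in>W. canonical_form B x y = \<nu> * G x y"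
  then obtain \<nu> where \<nu>: "\<And>x y. x \<in> W \<Longrightarrow> y \<in> W \<Longrightarrow> canonical_form B x y = \<nu> * G x y"
    by blast
  have "canonical_form B x y = \<nu> * G x y" if x: "x \<in> W" for x y
  proof -
    obtain \<alpha> where \<alpha>: "\<alpha> \<in> \<Pi>" "x = sharp G \<alpha>" using x W by auto
    define \<gamma> where "\<gamma> = (\<Sum>\<beta>\<in>B. fscale (\<beta> x) \<beta>) - fscale \<nu> \<alpha>"
    have \<gamma>: "\<gamma> \<in> \<Pi>"
      unfolding \<gamma>_def using B \<alpha> \<Pi>(1)
      by (intro covec.subspace_diff covec.subspace_sum covec.subspace_scale) auto
    have Gx: "G x z = \<alpha> z" for z
      using sharp_eq[OF fd G] \<alpha> \<Pi>(2) by auto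
    have "(\<Sum>\<beta>\<in>B. fscale (\<beta> x) \<beta>) z = (\<Sum>\<beta>\<in>B. fscale (\<beta> x) \<beta> z)" for z
      by (induction B rule: infinite_finite_induct) auto
    then have \<gamma>z: "\<gamma> z = canonical_form B x z - \<nu> * G x z" for z
      by (simp add: \<gamma>_def canonical_form_def fscale_def Gx)
    have G\<gamma>: "G (sharp G \<gamma>) z = \<gamma> z" for z
      using sharp_eq[OF fd G] \<gamma> \<Pi>(2) by auto
    have "sharp G \<gamma> = 0"
      using nondeg \<gamma> W \<nu>[OF x] by (auto simp: G\<gamma> \<gamma>z)
    then have "\<gamma> y = 0"
      using G\<gamma>[of y] mem_dual(3)[of "G y" sc] G by (simp add: complex_euclidean_def)
    then show ?thesis by (simp add: \<gamma>z)
  qed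
  then show "well_distributed G W B" unfolding well_distributed_def by blast
qed (auto simp: well_distributed_def)

definition reducible_pair :: "('v \<Rightarrow> 'v \<Rightarrow> complex) \<Rightarrow> ('v \<Rightarrow> complex) set \<Rightarrow> bool" where
  "reducible_pair G B \<longleftrightarrow> (\<exists>\<alpha> \<beta>. \<alpha> \<noteq> \<beta> \<and> B = {\<alpha>, \<beta>} \<and> G (sharp G \<alpha>) (sharp G \<beta>) = 0)"

text \<open>A plane \<open>\<Pi>\<close> carries a two-dimensional subsystem when \<open>A \<inter> \<Pi>\<close> spans it.\<close>

definition complex_euclidean_vee_system ::
    "(complex \<Rightarrow> 'v::ab_group_add \<Rightarrow> 'v) \<Rightarrow> ('v \<Rightarrow> 'v \<Rightarrow> complex) \<Rightarrow> ('v \<Rightarrow> complex) set \<Rightarrow> bool"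
  where
  "complex_euclidean_vee_system sc G A \<longleftrightarrow>
     finite A \<and> A \<subseteq> dual sc \<and> pairwise_noncollinear A \<and>
     well_distributed G UNIV A \<and>
     (\<forall>\<Pi>. covector_plane sc \<Pi> \<and> covec.span (A \<inter> \<Pi>) = \<Pi> \<longrightarrow>
        reducible_pair G (A \<inter> \<Pi>) \<or> well_distributed G (sharp G ` \<Pi>) (A \<inter> \<Pi>))"

definition hyperplane :: "(complex \<Rightarrow> 'v::ab_group_add \<Rightarrow> 'v) \<Rightarrow> 'v set \<Rightarrow> bool" where
  "hyperplane sc H \<longleftrightarrow> module.subspace sc H \<and>
     vector_space.dim sc H + 1 = vector_space.dim sc UNIV"

definition central_arrangement :: "(complex \<Rightarrow> 'v::ab_group_add \<Rightarrow> 'v) \<Rightarrow> 'v set set \<Rightarrow> bool" where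
  "central_arrangement sc \<Delta> \<longleftrightarrow> finite \<Delta> \<and> (\<forall>H\<in>\<Delta>. hyperplane sc H)"

definition equipment ::
    "(complex \<Rightarrow> 'v::ab_group_add \<Rightarrow> 'v) \<Rightarrow> 'v set set \<Rightarrow> ('v \<Rightarrow> complex) set \<Rightarrow> bool" where
  "equipment sc \<Delta> A \<longleftrightarrow>
     (\<exists>a. A = a ` \<Delta> \<and> (\<forall>H\<in>\<Delta>. a H \<in> dual sc \<and> H = {x. a H x = 0})) \<and>
     covec.span A = dual sc"

definition decomposable ::
    "(complex \<Rightarrow> 'v::ab_group_add \<Rightarrow> 'v) \<Rightarrow> ('v \<Rightarrow> complex) set \<Rightarrow> bool" where
  "decomposable sc A \<longleftrightarrow>
     (\<exists>V1 V2. covec.subspace V1 \<and> covec.subspace V2 \<and> V1 \<noteq> {0} \<and> V2 \<noteq> {0} \<and>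
        V1 \<inter> V2 = {0} \<and> {f + g | f g. f \<in> V1 \<and> g \<in> V2} = dual sc \<and>
        A = (A \<inter> V1) \<union> (A \<inter> V2))"

text \<open>The choice of the equipment does not matter, see \<open>irreducible_arrangement_iff\<close> below.\<close>

definition irreducible_arrangement ::
    "(complex \<Rightarrow> 'v::ab_group_add \<Rightarrow> 'v) \<Rightarrow> 'v set set \<Rightarrow> bool" where
  "irreducible_arrangement sc \<Delta> \<longleftrightarrow> (\<forall>A. equipment sc \<Delta> A \<longrightarrow> \<not> decomposable sc A)"

lemma dual_proportional:
  assumes "vector_space sc" "f \<in> dual sc" "g \<in> dual sc" "\<And>x. f x = 0 \<longleftrightarrow> g x = 0"
  shows "\<exists>c. g = fscale c f"
proof (cases "\<exists>v. f v \<noteq> 0")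
  case True
  then obtain v where v: "f v \<noteq> 0" by blast
  have "g x = g v / f v * f x" for x
  proof -
    have "f (x - sc (f x / f v) v) = 0" using v by (simp add: mem_dual[OF assms(2)])
    then have "g (x - sc (f x / f v) v) = 0" using assms(4) by blast
    then show ?thesis using v by (simp add: mem_dual[OF assms(3)] field_simps)
  qed
  then have "g = fscale (g v / f v) f" unfolding fscale_def by (rule ext)
  then show ?thesis by blast
next
  case False
  with assms(4) have "g = fscale 0 f" by (auto simp: fscale_def)
  then show ?thesis by blast
qed

lemma irreducible_arrangement_iff:
  assumes sc: "vector_space sc" and A: "equipment sc \<Delta> A"
  shows "irreducible_arrangement sc \<Delta> \<longleftrightarrow> \<not> decomposable sc A"
proof -
  have "decomposable sc A" if A': "equipment sc \<Delta> A'" and dec: "decomposable sc A'" for A'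
  proof -
    obtain a where a: "A = a ` \<Delta>" "\<And>H. H \<in> \<Delta> \<Longrightarrow> a H \<in> dual sc \<and> H = {x. a H x = 0}"
      using A by (auto simp: equipment_def)
    obtain b where b: "A' = b ` \<Delta>" "\<And>H. H \<in> \<Delta> \<Longrightarrow> b H \<in> dual sc \<and> H = {x. b H x = 0}"
      using A' by (auto simp: equipment_def)
    have "\<exists>c. a H = fscale c (b H)" if "H \<in> \<Delta>" for H
      using a(2)[OF that] b(2)[OF that] by (intro dual_proportional[OF sc]) blast+
    then have ab: "a H \<in> V" if "H \<in> \<Delta>" "b H \<in> V" "covec.subspace V" for H V
      using that covec.subspace_scale by metis
    obtain V1 V2 where V: "covec.subspace V1" "covec.subspace V2" "V1 \<noteq> {0}" "V2 \<noteq> {0}"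
        "V1 \<inter> V2 = {0}" "{f + g | f g. f \<in> V1 \<and> g \<in> V2} = dual sc"
        "A' = (A' \<inter> V1) \<union> (A' \<inter> V2)"
      using dec unfolding decomposable_def by blast
    have "b H \<in> V1 \<or> b H \<in> V2" if "H \<in> \<Delta>" for H
      using V(7) b(1) that by blast
    then have "A = (A \<inter> V1) \<union> (A \<inter> V2)"
      using ab V(1,2) a(1) by blast
    with V show ?thesis unfolding decomposable_def by blast
  qed
  with A show ?thesis unfolding irreducible_arrangement_def by blast
qed

text \<open>The sum of generators in a relation is a term, hence is written along an enumeration \<open>bs\<close>
  of \<open>A \<inter> \<Pi>\<close>; all enumerations give the same element of the Lie algebra.\<close>

definition holonomy_relations ::
    "(complex \<Rightarrow> 'v::ab_group_add \<Rightarrow> 'v) \<Rightarrow> ('v \<Rightarrow> complex) set \<Rightarrow> ('v \<Rightarrow> complex) lie_term set" where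
  "holonomy_relations sc A =
     {Bracket (Gen \<alpha>) (foldr Add (map Gen bs) Zero) | \<alpha> \<Pi> bs.
        covector_plane sc \<Pi> \<and> \<alpha> \<in> A \<inter> \<Pi> \<and> distinct bs \<and> set bs = A \<inter> \<Pi>}"

definition holonomy_lie_algebra ::
    "(complex \<Rightarrow> 'v::ab_group_add \<Rightarrow> 'v) \<Rightarrow> ('v \<Rightarrow> complex) set \<Rightarrow>
     ('v \<Rightarrow> complex) lie_term set lie_structure" where
  "holonomy_lie_algebra sc A = presented_lie A (holonomy_relations sc A)"

definition holonomy_gen ::
    "(complex \<Rightarrow> 'v::ab_group_add \<Rightarrow> 'v) \<Rightarrow> ('v \<Rightarrow> complex) set \<Rightarrow> ('v \<Rightarrow> complex) \<Rightarrow>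
     ('v \<Rightarrow> complex) lie_term set" where
  "holonomy_gen sc A \<alpha> = lie_class A (holonomy_relations sc A) (Gen \<alpha>)"

definition End_lie :: "(complex \<Rightarrow> 'v::ab_group_add \<Rightarrow> 'v) \<Rightarrow> ('v \<Rightarrow> 'v) lie_structure" where
  "End_lie sc = \<lparr>
     lie_carrier = {f. Vector_Spaces.linear sc sc f},
     lie_zero = (\<lambda>x. 0),
     lie_add = (\<lambda>f g x. f x + g x),
     lie_smult = (\<lambda>c f x. sc c (f x)),
     lie_bracket = (\<lambda>f g x. f (g x) - g (f x))\<rparr>"

lemma complex_lie_algebra_End:
  assumes "vector_space sc"
  shows "complex_lie_algebra (End_lie sc)"
proof -
  interpret vector_space sc by fact
  have lin: "Vector_Spaces.linear sc sc f \<longleftrightarrow>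
      (\<forall>x y. f (x + y) = f x + f y) \<and> (\<forall>c x. f (sc c x) = sc c (f x))" for f
    using assms by (auto simp: Vector_Spaces.linear_def module_hom_def module_hom_axioms_def
        module_iff_vector_space)
  have diff: "f (x - y) = f x - f y"
    if "\<forall>x y. f (x + y) = f x + f y" "\<forall>c x. f (sc c x) = sc c (f x)" for f x y
    using that(1)[rule_format, of x "sc (- 1) y"] that(2)[rule_format, of "- 1" y] by simp
  have zero: "f 0 = 0" if "\<forall>x y. f (x + y) = f x + f y" for f :: "'a \<Rightarrow> 'a"
    using that[rule_format, of 0 0] by simp
  show ?thesis
    by unfold_locales
      (auto simp: End_lie_def lin fun_eq_iff diff zero algebra_simps scale_right_diff_distrib
        mult.commute)
qed

text \<open>A representation is determined by its values on the generators
  (lemma \<open>lie_hom_presented_unique\<close>), so the prescribed values define a representation exactly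
  when some representation attains them.\<close>

definition defines_representation ::
    "(complex \<Rightarrow> 'v::ab_group_add \<Rightarrow> 'v) \<Rightarrow> ('v \<Rightarrow> complex) set \<Rightarrow>
     (('v \<Rightarrow> complex) \<Rightarrow> 'v \<Rightarrow> 'v) \<Rightarrow> bool" where
  "defines_representation sc A T \<longleftrightarrow>
     (\<exists>\<rho>. lie_hom (holonomy_lie_algebra sc A) (End_lie sc) \<rho> \<and>
          (\<forall>\<alpha>\<in>A. \<rho> (holonomy_gen sc A \<alpha>) = T \<alpha>))"

end

theory Submission
  imports Defs
begin

text \<open>For a set \<open>B\<close> of covectors let \<open>M\<^sub>B f = (\<Sum>\<beta>\<in>B. (f, \<beta>) \<beta>)\<close>, an operator on \<open>V\<^sup>*\<close> that is
  self-adjoint with respect to \<open>G\<close>.  The commutator of \<open>\<rho>(t\<^sub>\<alpha>)\<close> with \<open>\<Sum>\<beta>\<in>A \<inter> \<Pi>. \<rho>(t\<^sub>\<beta>)\<close>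
  corresponds under \<open>G\<close> to the bivector \<open>M f \<and> f\<close> at \<open>f = \<alpha>\<close> with \<open>M = M\<^bsub>A \<inter> \<Pi>\<^esub>\<close>, so \<open>\<rho>\<close> is a representation iff
  every \<open>\<alpha> \<in> A \<inter> \<Pi>\<close> is an eigenvector of \<open>M\<^bsub>A \<inter> \<Pi>\<^esub>\<close>, for all planes \<open>\<Pi>\<close>.  This is the \<open>\<or>\<close>-condition,
  giving the first two parts.  Conversely, on a plane with three pairwise non-collinear
  eigenvectors \<open>M\<^bsub>A \<inter> \<Pi>\<^esub>\<close> is scalar, and if there are only two then they are orthogonal.  Summing over
  the planes through \<open>\<alpha>\<close> shows that \<open>\<alpha>\<close> is an eigenvector of \<open>M\<^sub>A\<close>; since eigenvectors for different
  eigenvalues are orthogonal, two eigenvalues would decompose the arrangement.\<close>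

section \<open>Homomorphisms out of a presented Lie algebra\<close>

primrec lie_eval :: "'m lie_structure \<Rightarrow> ('g \<Rightarrow> 'm) \<Rightarrow> 'g lie_term \<Rightarrow> 'm" where
  "lie_eval M T (Gen a) = T a"
| "lie_eval M T Zero = lie_zero M"
| "lie_eval M T (Add s t) = lie_add M (lie_eval M T s) (lie_eval M T t)"
| "lie_eval M T (Smult c s) = lie_smult M c (lie_eval M T s)"
| "lie_eval M T (Bracket s t) = lie_bracket M (lie_eval M T s) (lie_eval M T t)"

lemma lie_eval_closed:
  assumes "complex_lie_algebra M" "T ` X \<subseteq> lie_carrier M" "t \<in> lie_terms X"
  shows "lie_eval M T t \<in> lie_carrier M"
proof -
  interpret complex_lie_algebra M by fact
  show ?thesis
    using assms(3) by (induction t)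
      (use assms(2) in \<open>auto intro: zero_closed add_closed smult_closed bracket_closed\<close>)
qed

lemma lie_cong_terms:
  assumes "lie_cong X R s t"
  shows "s \<in> lie_terms X \<and> t \<in> lie_terms X"
  using assms by (induction rule: lie_cong.induct) auto

lemma lie_cong_eval_eq:
  assumes M: "complex_lie_algebra M" and T: "T ` X \<subseteq> lie_carrier M"
    and R: "\<And>r. r \<in> R \<Longrightarrow> r \<in> lie_terms X \<Longrightarrow> lie_eval M T r = lie_zero M"
    and st: "lie_cong X R s t"
  shows "lie_eval M T s = lie_eval M T t"
proof -
  interpret complex_lie_algebra M by fact
  note cl = lie_eval_closed[OF M T]
  show ?thesis
    using st
    by (induction rule: lie_cong.induct)
      (simp_all add: cl R add_assoc add_zero smult_add add_smult smult_smult smult_one smult_zero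
        bracket_add bracket_smult add_bracket smult_bracket bracket_self jacobi,
        metis cl add_commute)
qed

text \<open>The universal property of the presentation. A homomorphism with the prescribed values on
  generators must be evaluation of terms, so the relations evaluate to zero; conversely, if they do,
  evaluation is constant on congruence classes and descends.\<close>

lemma lie_hom_presented_iff:
  assumes M: "complex_lie_algebra M" and T: "T ` X \<subseteq> lie_carrier M" and R: "R \<subseteq> lie_terms X"
  shows "(\<exists>\<rho>. lie_hom (presented_lie X R) M \<rho> \<and> (\<forall>a\<in>X. \<rho> (lie_class X R (Gen a)) = T a)) \<longleftrightarrow>
    (\<forall>r\<in>R. lie_eval M T r = lie_zero M)"
proof
  assume "\<exists>\<rho>. lie_hom (presented_lie X R) M \<rho> \<and> (\<forall>a\<in>X. \<rho> (lie_class X R (Gen a)) = T a)"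
  then obtain \<rho> where \<rho>: "lie_hom (presented_lie X R) M \<rho>"
    and gen: "\<And>a. a \<in> X \<Longrightarrow> \<rho> (lie_class X R (Gen a)) = T a" by blast
  have ops: "\<rho> (lie_class X R (Add s t)) =
        lie_add M (\<rho> (lie_class X R s)) (\<rho> (lie_class X R t))"
      "\<rho> (lie_class X R (Smult c s)) = lie_smult M c (\<rho> (lie_class X R s))"
      "\<rho> (lie_class X R (Bracket s t)) =
        lie_bracket M (\<rho> (lie_class X R s)) (\<rho> (lie_class X R t))"
      "\<rho> (lie_class X R s) \<in> lie_carrier M"
    if "s \<in> lie_terms X" "t \<in> lie_terms X" for s t c
    using that \<rho> by (auto simp: lie_hom_def presented_lie_carrier
        simp flip: presented_lie_ops[where X = X and R = R])
  \<comment> \<open>\<open>lie_hom\<close> does not ask that zero be preserved. Writing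
    \<open>Zero\<close> as 0 times itself derives this from compatibility with scalars.\<close>
  have "lie_class X R Zero = lie_class X R (Smult 0 Zero)"
    by (intro lie_class_eqI lie_cong.sym[OF lie_cong.Smult_zero]) simp
  then have zero: "\<rho> (lie_class X R Zero) = lie_zero M"
    using ops(2)[of Zero Zero 0] ops(4)[of Zero Zero] complex_lie_algebra.smult_zero[OF M]
    by (metis lie_terms_simps(2))
  have eval: "\<rho> (lie_class X R t) = lie_eval M T t" if "t \<in> lie_terms X" for t
    using that by (induction t) (simp_all add: gen ops zero)
  show "\<forall>r\<in>R. lie_eval M T r = lie_zero M"
  proof
    fix r assume "r \<in> R"
    with R have r: "r \<in> lie_terms X" by blast
    have "lie_class X R r = lie_class X R Zero"
      by (intro lie_class_eqI lie_cong.relation) fact+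
    then show "lie_eval M T r = lie_zero M"
      using eval[OF r] zero by simp
  qed
next
  assume rel: "\<forall>r\<in>R. lie_eval M T r = lie_zero M"
  \<comment> \<open>The representative is arbitrary; by \<open>lie_cong_eval_eq\<close> and the
    vanishing of the relations its choice does not affect the value.\<close>
  define \<rho> where "\<rho> P = lie_eval M T (SOME s. s \<in> P)" for P
  have \<rho>: "\<rho> (lie_class X R t) = lie_eval M T t" if "t \<in> lie_terms X" for t
  proof -
    have "t \<in> lie_class X R t" using that by (simp add: lie_class_def lie_cong.refl)
    then have "(SOME s. s \<in> lie_class X R t) \<in> lie_class X R t" by (rule someI)
    then have "lie_cong X R t (SOME s. s \<in> lie_class X R t)"
      unfolding lie_class_def by blast
    then show ?thesis
      unfolding \<rho>_def using lie_cong_eval_eq[OF M T] rel by metis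
  qed
  have "lie_hom (presented_lie X R) M \<rho>"
    unfolding lie_hom_def presented_lie_carrier
    using lie_eval_closed[OF M T] by (auto simp: presented_lie_ops \<rho>)
  moreover have "\<forall>a\<in>X. \<rho> (lie_class X R (Gen a)) = T a"
    by (simp add: \<rho>)
  ultimately show "\<exists>\<rho>. lie_hom (presented_lie X R) M \<rho> \<and>
      (\<forall>a\<in>X. \<rho> (lie_class X R (Gen a)) = T a)" by blast
qed

lemma lie_eval_End_sum:
  assumes "distinct bs"
  shows "lie_eval (End_lie sc) T (foldr Add (map Gen bs) Zero) = (\<lambda>x. \<Sum>\<beta>\<in>set bs. T \<beta> x)"
  using assms by (induction bs) (simp_all add: End_lie_def)

lemma defines_representation_iff:
  assumes sc: "vector_space sc" and fin: "finite A"
    and T: "\<And>\<alpha>. \<alpha> \<in> A \<Longrightarrow> Vector_Spaces.linear sc sc (T \<alpha>)"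
  shows "defines_representation sc A T \<longleftrightarrow>
    (\<forall>\<Pi> \<alpha>. covector_plane sc \<Pi> \<and> \<alpha> \<in> A \<inter> \<Pi> \<longrightarrow>
       (\<forall>x. T \<alpha> (\<Sum>\<beta>\<in>A \<inter> \<Pi>. T \<beta> x) = (\<Sum>\<beta>\<in>A \<inter> \<Pi>. T \<beta> (T \<alpha> x))))"
proof -
  have terms: "foldr Add (map Gen bs) Zero \<in> lie_terms X" if "set bs \<subseteq> X"
    for bs :: "('v \<Rightarrow> complex) list" and X
    using that by (induction bs) auto
  have "holonomy_relations sc A \<subseteq> lie_terms A"
    unfolding holonomy_relations_def by (auto intro!: terms)
  moreover have "T ` A \<subseteq> lie_carrier (End_lie sc)"
    using T by (auto simp: End_lie_def)
  ultimately have "defines_representation sc A T \<longleftrightarrow>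
      (\<forall>r\<in>holonomy_relations sc A. lie_eval (End_lie sc) T r = lie_zero (End_lie sc))"
    unfolding defines_representation_def holonomy_lie_algebra_def holonomy_gen_def
    by (intro lie_hom_presented_iff complex_lie_algebra_End sc)
  also have "\<dots> \<longleftrightarrow> (\<forall>\<Pi> \<alpha> bs. covector_plane sc \<Pi> \<and> \<alpha> \<in> A \<inter> \<Pi> \<and> distinct bs \<and> set bs = A \<inter> \<Pi> \<longrightarrow>
      lie_eval (End_lie sc) T (Bracket (Gen \<alpha>) (foldr Add (map Gen bs) Zero))
        = lie_zero (End_lie sc))"
    unfolding holonomy_relations_def by blast
  also have "\<dots> \<longleftrightarrow> (\<forall>\<Pi> \<alpha> bs. covector_plane sc \<Pi> \<and> \<alpha> \<in> A \<inter> \<Pi> \<and> distinct bs \<and> set bs = A \<inter> \<Pi> \<longrightarrow>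
      (\<forall>x. T \<alpha> (\<Sum>\<beta>\<in>A \<inter> \<Pi>. T \<beta> x) = (\<Sum>\<beta>\<in>A \<inter> \<Pi>. T \<beta> (T \<alpha> x))))"
  proof -
    have comm: "lie_eval (End_lie sc) T (Bracket (Gen \<alpha>) (foldr Add (map Gen bs) Zero))
        = lie_zero (End_lie sc) \<longleftrightarrow>
      (\<forall>x. T \<alpha> (\<Sum>\<beta>\<in>B. T \<beta> x) = (\<Sum>\<beta>\<in>B. T \<beta> (T \<alpha> x)))"
      if "distinct bs" "set bs = B" for \<alpha> bs B
      unfolding lie_eval.simps lie_eval_End_sum[OF that(1)] that(2)
      by (simp add: End_lie_def fun_eq_iff)
    show ?thesis by (intro iff_allI imp_cong refl comm) auto
  qed
  also have "\<dots> \<longleftrightarrow> (\<forall>\<Pi> \<alpha>. covector_plane sc \<Pi> \<and> \<alpha> \<in> A \<inter> \<Pi> \<longrightarrow>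
       (\<forall>x. T \<alpha> (\<Sum>\<beta>\<in>A \<inter> \<Pi>. T \<beta> x) = (\<Sum>\<beta>\<in>A \<inter> \<Pi>. T \<beta> (T \<alpha> x))))"
  proof -
    have "\<exists>bs. distinct bs \<and> set bs = A \<inter> \<Pi>" for \<Pi>
      using finite_distinct_list[of "A \<inter> \<Pi>"] fin by auto
    then show ?thesis by (simp only: all_simps ex_simps simp_thms)
  qed
  finally show ?thesis .
qed

section \<open>Pairs of covectors and the planes they span\<close>

lemma covec_independent_pair_iff:
  assumes "\<alpha> \<noteq> \<beta>"
  shows "covec.independent {\<alpha>, \<beta>} \<longleftrightarrow>
    (\<forall>c d. (\<forall>y. c * \<alpha> y + d * \<beta> y = 0) \<longrightarrow> c = 0 \<and> d = 0)"
proof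
  assume ind: "covec.independent {\<alpha>, \<beta>}"
  show "\<forall>c d. (\<forall>y. c * \<alpha> y + d * \<beta> y = 0) \<longrightarrow> c = 0 \<and> d = 0"
  proof (intro allI impI)
    fix c d assume eq: "\<forall>y. c * \<alpha> y + d * \<beta> y = 0"
    define u where "u = (\<lambda>f. if f = \<alpha> then c else d)"
    have "(\<Sum>f\<in>{\<alpha>, \<beta>}. fscale (u f) f) = 0"
      using assms eq by (auto simp: u_def fscale_def fun_eq_iff)
    then have "u \<alpha> = 0" "u \<beta> = 0"
      using covec.independentD[OF ind _ order_refl, of u] by auto
    with assms show "c = 0 \<and> d = 0" by (auto simp: u_def)
  qed
next
  assume eq: "\<forall>c d. (\<forall>y. c * \<alpha> y + d * \<beta> y = 0) \<longrightarrow> c = 0 \<and> d = 0"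
  show "covec.independent {\<alpha>, \<beta>}"
  proof
    assume "covec.dependent {\<alpha>, \<beta>}"
    then obtain u where u: "\<exists>f\<in>{\<alpha>, \<beta>}. u f \<noteq> 0" "(\<Sum>f\<in>{\<alpha>, \<beta>}. fscale (u f) f) = 0"
      by (subst (asm) covec.dependent_finite) auto
    have "\<forall>y. u \<alpha> * \<alpha> y + u \<beta> * \<beta> y = 0"
      using u(2) assms by (simp add: fscale_def fun_eq_iff)
    with eq u(1) show False by blast
  qed
qed

text \<open>The ambient space of all functions may be infinite-dimensional, so the pair is extended
  to a basis of the plane itself; that basis has two elements, so nothing was added.\<close>

lemma plane_eq_span:
  assumes \<Pi>: "covector_plane sc \<Pi>" and ind: "covec.independent {\<alpha>, \<beta>}"
    and ne: "\<alpha> \<noteq> \<beta>" and mem: "\<alpha> \<in> \<Pi>" "\<beta> \<in> \<Pi>"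
  shows "covec.span {\<alpha>, \<beta>} = \<Pi>"
proof
  have sub: "covec.subspace \<Pi>" and dim: "covec.dim \<Pi> = 2"
    using \<Pi> by (auto simp: covector_plane_def)
  show "covec.span {\<alpha>, \<beta>} \<subseteq> \<Pi>"
    using sub mem by (intro covec.span_minimal) auto
  obtain B where B: "{\<alpha>, \<beta>} \<subseteq> B" "B \<subseteq> \<Pi>" "covec.independent B" "\<Pi> \<subseteq> covec.span B"
    by (rule covec.maximal_independent_subset_extend[of "{\<alpha>, \<beta>}" \<Pi>]) (use mem ind in auto)
  have card: "card B = 2"
    using covec.basis_card_eq_dim[OF B(2,4,3)] dim by simp
  then have "{\<alpha>, \<beta>} = B"
    using B(1) ne by (intro card_subset_eq) (auto intro: card_ge_0_finite)
  then show "\<Pi> \<subseteq> covec.span {\<alpha>, \<beta>}" using B(4) by simp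
qed

lemma covector_plane_span:
  assumes "vector_space sc" "covec.independent {\<alpha>, \<beta>}" "\<alpha> \<noteq> \<beta>" "\<alpha> \<in> dual sc" "\<beta> \<in> dual sc"
  shows "covector_plane sc (covec.span {\<alpha>, \<beta>})"
proof -
  have "covec.span {\<alpha>, \<beta>} \<subseteq> dual sc"
    using assms by (intro covec.span_minimal subspace_dual) auto
  then show ?thesis
    using assms covec.dim_span_eq_card_independent[of "{\<alpha>, \<beta>}"]
    by (simp add: covector_plane_def)
qed

section \<open>The operator M_B on covectors and its eigenvectors\<close>

text \<open>The covector M_B f evaluated at \<open>y\<close>: the product of f and \<beta> is f
  applied to the vector \<open>sharp G \<beta>\<close>.\<close>

definition moment ::
    "('v \<Rightarrow> 'v \<Rightarrow> complex) \<Rightarrow> ('v \<Rightarrow> complex) set \<Rightarrow> ('v \<Rightarrow> complex) \<Rightarrow> 'v \<Rightarrow> complex" where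
  "moment G B f y = (\<Sum>\<beta>\<in>B. f (sharp G \<beta>) * \<beta> y)"

text \<open>The zero covector counts as an eigenvector for every \<nu>, so that the eigenvectors for
  a fixed \<nu> form a subspace.\<close>

definition moment_eigen ::
    "('v \<Rightarrow> 'v \<Rightarrow> complex) \<Rightarrow> ('v \<Rightarrow> complex) set \<Rightarrow> complex \<Rightarrow> ('v \<Rightarrow> complex) \<Rightarrow> bool" where
  "moment_eigen G B \<nu> f \<longleftrightarrow> (\<forall>y. moment G B f y = \<nu> * f y)"

lemma moment_eigen_span:
  assumes "\<And>f. f \<in> S \<Longrightarrow> moment_eigen G B \<nu> f" "f \<in> covec.span S"
  shows "moment_eigen G B \<nu> f"
  using assms(2)
proof (induction rule: covec.span_induct)
  case base
  have "(\<Sum>\<beta>\<in>B. (f (sharp G \<beta>) + g (sharp G \<beta>)) * \<beta> y) = \<nu> * (f y + g y)"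
    if "(\<Sum>\<beta>\<in>B. f (sharp G \<beta>) * \<beta> y) = \<nu> * f y" "(\<Sum>\<beta>\<in>B. g (sharp G \<beta>) * \<beta> y) = \<nu> * g y"
    for f g y
    using that by (simp add: ring_distribs sum.distrib)
  moreover have "(\<Sum>\<beta>\<in>B. c * f (sharp G \<beta>) * \<beta> y) = \<nu> * (c * f y)"
    if "(\<Sum>\<beta>\<in>B. f (sharp G \<beta>) * \<beta> y) = \<nu> * f y" for f y c
    using that by (simp add: mult.assoc flip: sum_distrib_left)
  ultimately show ?case
    by (auto simp: covec.subspace_def moment_eigen_def moment_def fscale_def)
qed (use assms(1) in auto)

section \<open>Vectors and covectors in a complex Euclidean space\<close>

locale complex_euclidean_space = finite_dimensional_vector_space sc basis
  for sc :: "complex \<Rightarrow> 'v::ab_group_add \<Rightarrow> 'v" and basis :: "'v set" +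
  fixes G :: "'v \<Rightarrow> 'v \<Rightarrow> complex"
  assumes euclidean: "complex_euclidean sc G"
begin

lemma fd: "finite_dimensional_vector_space sc basis" ..

lemma vs: "vector_space sc" ..

lemma G_dual: "G x \<in> dual sc"
  and G_sym: "G x y = G y x"
  and G_nondeg: "(\<And>y. G x y = 0) \<Longrightarrow> x = 0"
  using euclidean by (auto simp: complex_euclidean_def nondegenerate_def)

lemma G_left: "G (x + y) z = G x z + G y z" "G (sc c x) z = c * G x z"
    "G (x - y) z = G x z - G y z" "G (sum h B) z = (\<Sum>b\<in>B. G (h b) z)" "G 0 z = 0"
  using mem_dual[OF G_dual[of z]] by (simp_all add: G_sym[of _ z])

lemma G_sharp [simp]: "\<alpha> \<in> dual sc \<Longrightarrow> G (sharp G \<alpha>) x = \<alpha> x"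
  by (rule sharp_eq[OF fd euclidean])

lemma sharp_G: "sharp G (G x) = x"
  by (rule sharp_eqI[OF euclidean]) simp

lemma apply_sharp_commute:
  assumes "\<alpha> \<in> dual sc" "\<beta> \<in> dual sc"
  shows "\<alpha> (sharp G \<beta>) = \<beta> (sharp G \<alpha>)"
  using assms G_sharp G_sym by metis

lemma eq_iff_G: "x = y \<longleftrightarrow> (\<forall>z. G x z = G y z)"
proof
  assume "\<forall>z. G x z = G y z"
  then have "x - y = 0" by (intro G_nondeg) (simp add: G_left)
  then show "x = y" by simp
qed simp

text \<open>The covectors vanishing at \<open>x\<close> form a subspace; containing
  \<open>A\<close>, it contains every \<open>G y\<close>, and non-degeneracy applies.\<close>

lemma zero_if_spanning_vanish:
  assumes span: "covec.span A = dual sc" and "\<And>\<alpha>. \<alpha> \<in> A \<Longrightarrow> \<alpha> x = 0"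
  shows "x = 0"
proof (rule G_nondeg)
  fix y
  have "covec.subspace {f. f x = 0}"
    by (auto simp: covec.subspace_def fscale_def)
  then have "covec.span A \<subseteq> {f. f x = 0}"
    using assms(2) by (intro covec.span_minimal) auto
  then show "G x y = 0"
    using span G_dual[of y] G_sym[of x y] by auto
qed

lemma canonical_form_moment:
  assumes "B \<subseteq> dual sc" "f \<in> dual sc"
  shows "canonical_form B (sharp G f) y = moment G B f y"
  unfolding canonical_form_def moment_def
  using assms by (intro sum.cong refl) (auto simp: apply_sharp_commute)

text \<open>Since the second argument in \<open>well_distributed\<close> runs through the whole
  space, the condition is an identity of covectors: M_B is scalar on \<Pi>. Taking \<Pi> to be the
  whole dual covers the global condition as well.\<close>

lemma well_distributed_sharp_iff:
  assumes "B \<subseteq> dual sc" "\<Pi> \<subseteq> dual sc"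
  shows "well_distributed G (sharp G ` \<Pi>) B \<longleftrightarrow> (\<exists>\<nu>. \<forall>f\<in>\<Pi>. moment_eigen G B \<nu> f)"
proof -
  have "canonical_form B (sharp G f) y = \<nu> * G (sharp G f) y \<longleftrightarrow> moment G B f y = \<nu> * f y"
    if "f \<in> \<Pi>" for f y \<nu>
    using that assms canonical_form_moment by auto
  then show ?thesis
    unfolding well_distributed_def moment_eigen_def by simp
qed

lemma sharp_image_dual: "sharp G ` dual sc = UNIV"
  using sharp_G G_dual by (metis (mono_tags) UNIV_eq_I imageI)

lemma linear_rank_one:
  assumes "\<alpha> \<in> dual sc"
  shows "Vector_Spaces.linear sc sc (rank_one sc v \<alpha>)"
  unfolding Vector_Spaces.linear_iff
  by (simp add: vs rank_one_def mem_dual(1,2)[OF assms] scale_left_distrib)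

section \<open>Representations as eigenvector conditions\<close>

text \<open>Pairing the two products at \<open>x\<close> with \<open>y\<close> under
  \<open>G\<close> gives (M_B \<alpha>)(x) \<alpha>(y) and \<alpha>(x) (M_B \<alpha>)(y). They agree
  for all \<open>x\<close> and \<open>y\<close> exactly when M_B \<alpha> is a multiple of
  \<alpha>.\<close>

lemma rank_one_commutator_iff:
  assumes B: "B \<subseteq> dual sc" and \<alpha>: "\<alpha> \<in> dual sc"
  defines "T \<equiv> \<lambda>\<alpha>. rank_one sc (sharp G \<alpha>) \<alpha>"
  shows "(\<forall>x. T \<alpha> (\<Sum>\<beta>\<in>B. T \<beta> x) = (\<Sum>\<beta>\<in>B. T \<beta> (T \<alpha> x))) \<longleftrightarrow>
    (\<exists>\<nu>. moment_eigen G B \<nu> \<alpha>)"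
proof -
  have 1: "G (T \<alpha> (\<Sum>\<beta>\<in>B. T \<beta> x)) y = moment G B \<alpha> x * \<alpha> y" for x y
    using \<alpha> by (simp add: T_def rank_one_def G_left mem_dual[OF \<alpha>] moment_def mult.commute)
  have 2: "G (\<Sum>\<beta>\<in>B. T \<beta> (T \<alpha> x)) y = \<alpha> x * moment G B \<alpha> y" for x y
  proof -
    have "G (T \<beta> (T \<alpha> x)) y = \<alpha> x * (\<alpha> (sharp G \<beta>) * \<beta> y)" if "\<beta> \<in> B" for \<beta>
    proof -
      have \<beta>: "\<beta> \<in> dual sc" using that B by blast
      show ?thesis
        using \<beta> by (simp add: T_def rank_one_def G_left mem_dual[OF \<beta>] apply_sharp_commute[OF \<alpha> \<beta>])
    qed
    then show ?thesis by (simp add: G_left moment_def sum_distrib_left)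
  qed
  have "(\<forall>x. T \<alpha> (\<Sum>\<beta>\<in>B. T \<beta> x) = (\<Sum>\<beta>\<in>B. T \<beta> (T \<alpha> x))) \<longleftrightarrow>
      (\<forall>x y. moment G B \<alpha> x * \<alpha> y = \<alpha> x * moment G B \<alpha> y)"
    by (subst eq_iff_G) (simp only: 1 2)
  also have "\<dots> \<longleftrightarrow> (\<exists>\<nu>. moment_eigen G B \<nu> \<alpha>)"
  proof
    assume proportional: "\<forall>x y. moment G B \<alpha> x * \<alpha> y = \<alpha> x * moment G B \<alpha> y"
    show "\<exists>\<nu>. moment_eigen G B \<nu> \<alpha>"
    \<comment> \<open>The eigenvalue is read off at a point where \<alpha> does not vanish; for
      \<alpha> = 0 any value would do.\<close>
    proof (cases "\<exists>x. \<alpha> x \<noteq> 0")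
      case True
      then obtain x where "\<alpha> x \<noteq> 0" by blast
      with proportional have "moment_eigen G B (moment G B \<alpha> x / \<alpha> x) \<alpha>"
        by (simp add: moment_eigen_def field_simps)
      then show ?thesis by blast
    next
      case False
      then have "moment_eigen G B 0 \<alpha>" by (simp add: moment_eigen_def moment_def)
      then show ?thesis by blast
    qed
  qed (auto simp: moment_eigen_def)
  finally show ?thesis .
qed

text \<open>All three parts of the theorem pass through this equivalence; what remains of each is
  linear algebra in planes of covectors.\<close>

lemma representation_iff:
  assumes "finite A" and A: "A \<subseteq> dual sc"
  shows "defines_representation sc A (\<lambda>\<alpha>. rank_one sc (sharp G \<alpha>) \<alpha>) \<longleftrightarrow>
    (\<forall>\<Pi> \<alpha>. covector_plane sc \<Pi> \<and> \<alpha> \<in> A \<inter> \<Pi> \<longrightarrow> (\<exists>\<nu>. moment_eigen G (A \<inter> \<Pi>) \<nu> \<alpha>))"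
proof -
  have "(\<forall>x. rank_one sc (sharp G \<alpha>) \<alpha> (\<Sum>\<beta>\<in>A \<inter> \<Pi>. rank_one sc (sharp G \<beta>) \<beta> x) =
        (\<Sum>\<beta>\<in>A \<inter> \<Pi>. rank_one sc (sharp G \<beta>) \<beta> (rank_one sc (sharp G \<alpha>) \<alpha> x))) \<longleftrightarrow>
      (\<exists>\<nu>. moment_eigen G (A \<inter> \<Pi>) \<nu> \<alpha>)" if "\<alpha> \<in> A \<inter> \<Pi>" for \<alpha> \<Pi>
    using that A by (intro rank_one_commutator_iff) auto
  then show ?thesis
    using A by (subst defines_representation_iff[OF vs \<open>finite A\<close> linear_rank_one]) auto
qed

text \<open>Under \<open>G\<close> the sum of vectors becomes the covector M_B \<alpha>, because
  \<beta>(\<open>sharp G \<alpha>\<close>) is symmetric in \<alpha> and \<beta>. With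
  \<open>G\<close> the canonical form this is the condition defining a vee-system.\<close>

lemma vee_sum_iff_eigen:
  assumes B: "B \<subseteq> dual sc" and \<alpha>: "\<alpha> \<in> dual sc"
  shows "(\<Sum>\<beta>\<in>B. sc (\<beta> (sharp G \<alpha>)) (sharp G \<beta>)) = sc \<nu> (sharp G \<alpha>) \<longleftrightarrow> moment_eigen G B \<nu> \<alpha>"
proof -
  have "G (\<Sum>\<beta>\<in>B. sc (\<beta> (sharp G \<alpha>)) (sharp G \<beta>)) y = moment G B \<alpha> y" for y
    unfolding G_left moment_def using B \<alpha>
    by (intro sum.cong refl) (auto simp: apply_sharp_commute)
  then show ?thesis
    using \<alpha> by (subst eq_iff_G) (simp add: G_left moment_eigen_def)
qed

lemma representation_if_euclidean_vee:
  assumes "complex_euclidean_vee_system sc G A"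
  shows "defines_representation sc A (\<lambda>\<alpha>. rank_one sc (sharp G \<alpha>) \<alpha>)"
proof -
  have A: "finite A" "A \<subseteq> dual sc" "pairwise_noncollinear A"
    and planes: "\<And>\<Pi>. covector_plane sc \<Pi> \<Longrightarrow> covec.span (A \<inter> \<Pi>) = \<Pi> \<Longrightarrow>
        reducible_pair G (A \<inter> \<Pi>) \<or> well_distributed G (sharp G ` \<Pi>) (A \<inter> \<Pi>)"
    using assms by (auto simp: complex_euclidean_vee_system_def)
  have "\<exists>\<nu>. moment_eigen G (A \<inter> \<Pi>) \<nu> \<alpha>" if \<Pi>: "covector_plane sc \<Pi>" and \<alpha>: "\<alpha> \<in> A \<inter> \<Pi>" for \<Pi> \<alpha>
  \<comment> \<open>The relations also involve planes that meet \<open>A\<close> only in \<alpha>,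
    about which the hypothesis says nothing. There M has the single term (\<alpha>, \<alpha>)
    \<alpha>.\<close>
  proof (cases "A \<inter> \<Pi> = {\<alpha>}")
    case True
    then have "moment_eigen G (A \<inter> \<Pi>) (\<alpha> (sharp G \<alpha>)) \<alpha>"
      by (simp add: moment_eigen_def moment_def)
    then show ?thesis by blast
  next
    case False
    then obtain \<beta> where \<beta>: "\<beta> \<in> A \<inter> \<Pi>" "\<alpha> \<noteq> \<beta>" using \<alpha> by blast
    have "covec.independent {\<alpha>, \<beta>}"
      using A(3) \<alpha> \<beta> by (auto simp: pairwise_noncollinear_def pairwise_def)
    then have "covec.span {\<alpha>, \<beta>} = \<Pi>"
      using \<alpha> \<beta> by (intro plane_eq_span[OF \<Pi>]) auto
    then have "\<Pi> \<subseteq> covec.span (A \<inter> \<Pi>)"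
      using covec.span_mono[of "{\<alpha>, \<beta>}" "A \<inter> \<Pi>"] \<alpha> \<beta> by auto
    moreover have "covec.span (A \<inter> \<Pi>) \<subseteq> \<Pi>"
      using \<Pi> by (intro covec.span_minimal) (auto simp: covector_plane_def)
    ultimately consider "reducible_pair G (A \<inter> \<Pi>)" | "well_distributed G (sharp G ` \<Pi>) (A \<inter> \<Pi>)"
      using planes[OF \<Pi>] by blast
    then show ?thesis
    proof cases
      case 1
      \<comment> \<open>The orthogonal pair is renamed so that \<alpha> comes first; the term of M
        \<alpha> belonging to \<gamma> then vanishes.\<close>
      then obtain \<gamma> where \<gamma>: "A \<inter> \<Pi> = {\<alpha>, \<gamma>}" "\<alpha> \<noteq> \<gamma>" "G (sharp G \<alpha>) (sharp G \<gamma>) = 0"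
      proof -
        obtain \<delta> \<epsilon> where *: "A \<inter> \<Pi> = {\<delta>, \<epsilon>}" "\<delta> \<noteq> \<epsilon>" "G (sharp G \<delta>) (sharp G \<epsilon>) = 0"
          using 1 unfolding reducible_pair_def by blast
        then have "\<alpha> = \<delta> \<or> \<alpha> = \<epsilon>" using \<alpha> by simp
        then show thesis
        proof
          assume "\<alpha> = \<delta>"
          then show thesis using that[of \<epsilon>] * by simp
        next
          assume "\<alpha> = \<epsilon>"
          then show thesis
            using that[of \<delta>] * G_sym[of "sharp G \<delta>"] by (simp add: insert_commute)
        qed
      qed
      have "\<alpha> \<in> dual sc" using \<alpha> A(2) by blast
      then have "\<alpha> (sharp G \<gamma>) = 0" using \<gamma>(3) by simp
      then have "moment_eigen G (A \<inter> \<Pi>) (\<alpha> (sharp G \<alpha>)) \<alpha>"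
        unfolding \<gamma>(1) moment_eigen_def moment_def using \<gamma>(2) by simp
      then show ?thesis by blast
    next
      case 2
      have "A \<inter> \<Pi> \<subseteq> dual sc" "\<Pi> \<subseteq> dual sc" using A(2) \<Pi> by (auto simp: covector_plane_def)
      with 2 \<alpha> show ?thesis using well_distributed_sharp_iff by blast
    qed
  qed
  then show ?thesis using representation_iff[OF A(1,2)] by blast
qed

section \<open>From eigenvectors back to Euclidean vee-systems\<close>

lemma plane_alternative:
  assumes A: "finite A" "A \<subseteq> dual sc" "pairwise_noncollinear A" and \<Pi>: "covector_plane sc \<Pi>"
    and span: "covec.span (A \<inter> \<Pi>) = \<Pi>"
    and eigen: "\<And>\<alpha>. \<alpha> \<in> A \<inter> \<Pi> \<Longrightarrow> \<exists>\<nu>. moment_eigen G (A \<inter> \<Pi>) \<nu> \<alpha>"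
  shows "reducible_pair G (A \<inter> \<Pi>) \<or> well_distributed G (sharp G ` \<Pi>) (A \<inter> \<Pi>)"
proof -
  have "2 = covec.dim (A \<inter> \<Pi>)"
    using \<Pi> span covec.dim_span[of "A \<inter> \<Pi>"] by (simp add: covector_plane_def)
  also have "\<dots> \<le> card (A \<inter> \<Pi>)"
    using A(1) by (intro covec.dim_le_card') auto
  finally have "\<not> card (A \<inter> \<Pi>) \<le> Suc 0" by simp
  then obtain \<alpha> \<beta> where ab: "\<alpha> \<in> A \<inter> \<Pi>" "\<beta> \<in> A \<inter> \<Pi>" "\<alpha> \<noteq> \<beta>"
    using A(1) by (auto simp: card_le_Suc0_iff_eq)
  have indD: "c = 0 \<and> d = 0" if "f \<in> A" "g \<in> A" "f \<noteq> g" "\<And>y. c * f y + d * g y = 0" for f g c d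
  proof -
    have "covec.independent {f, g}"
      using A(3) that(1-3) by (simp add: pairwise_noncollinear_def pairwise_def)
    then show ?thesis
      using that(4) unfolding covec_independent_pair_iff[OF that(3)] by blast
  qed
  have ind: "covec.independent {\<alpha>, \<beta>}"
    using A(3) ab by (simp add: pairwise_noncollinear_def pairwise_def)
  have sp: "covec.span {\<alpha>, \<beta>} = \<Pi>"
    using ab by (intro plane_eq_span[OF \<Pi> ind]) auto
  obtain \<nu> where \<nu>: "moment_eigen G (A \<inter> \<Pi>) \<nu> \<alpha>" using eigen ab by blast
  obtain \<mu> where \<mu>: "moment_eigen G (A \<inter> \<Pi>) \<mu> \<beta>" using eigen ab by blast
  show ?thesis
  proof (cases "A \<inter> \<Pi> = {\<alpha>, \<beta>}")
    case True
    \<comment> \<open>With only two covectors the eigenvector equation reads (\<alpha>, \<alpha>)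
      \<alpha> + (\<alpha>, \<beta>) \<beta> = \<nu> \<alpha>, and independence forces the
      coefficient of \<beta> to vanish.\<close>
    have "(\<alpha> (sharp G \<alpha>) - \<nu>) * \<alpha> y + \<alpha> (sharp G \<beta>) * \<beta> y = 0" for y
      using \<nu> ab(3) unfolding True moment_eigen_def moment_def by (simp add: algebra_simps)
    from indD[OF _ _ ab(3) this] have "\<alpha> (sharp G \<beta>) = 0" using ab by blast
    then have "G (sharp G \<alpha>) (sharp G \<beta>) = 0" using ab A(2) by (auto simp: subset_iff)
    with True ab show ?thesis unfolding reducible_pair_def by blast
  next
    case False
    then obtain \<gamma> where \<gamma>: "\<gamma> \<in> A \<inter> \<Pi>" "\<gamma> \<noteq> \<alpha>" "\<gamma> \<noteq> \<beta>" using ab by blast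
    then have "\<gamma> \<in> covec.span {\<alpha>, \<beta>}" using sp by blast
    then obtain c d where "\<gamma> - fscale c \<alpha> = fscale d \<beta>"
      by (auto simp: covec.span_insert[of \<alpha>] covec.span_singleton)
    then have "\<gamma> = fscale c \<alpha> + fscale d \<beta>" by (simp add: algebra_simps)
    then have \<gamma>y: "\<gamma> y = c * \<alpha> y + d * \<beta> y" for y by (simp add: fscale_def)
    \<comment> \<open>Otherwise \<gamma> would be collinear with \<beta>, or with \<alpha> if
      \<open>d\<close> vanished.\<close>
    have "c \<noteq> 0" using indD[of \<gamma> \<beta> 1 "- d"] \<gamma> ab by (auto simp: \<gamma>y)
    moreover have "d \<noteq> 0" using indD[of \<gamma> \<alpha> 1 "- c"] \<gamma> ab by (auto simp: \<gamma>y)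
    moreover obtain \<kappa> where \<kappa>: "moment_eigen G (A \<inter> \<Pi>) \<kappa> \<gamma>" using eigen \<gamma> by blast
    \<comment> \<open>Apply M to \<gamma> = c \<alpha> + d \<beta> in two ways. As \<open>c\<close>
      and \<open>d\<close> are non-zero, independence makes both \<nu> and \<mu> equal to
      \<kappa>.\<close>
    have "c * (\<nu> - \<kappa>) * \<alpha> y + d * (\<mu> - \<kappa>) * \<beta> y = 0" for y
    proof -
      have "moment G (A \<inter> \<Pi>) \<gamma> y = c * moment G (A \<inter> \<Pi>) \<alpha> y + d * moment G (A \<inter> \<Pi>) \<beta> y"
        by (simp add: moment_def \<gamma>y ring_distribs sum.distrib sum_distrib_left mult.assoc)
      then show ?thesis
        using \<nu> \<mu> \<kappa> by (simp add: moment_eigen_def \<gamma>y algebra_simps)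
    qed
    ultimately have eq: "\<mu> = \<nu>"
      using indD[of \<alpha> \<beta> "c * (\<nu> - \<kappa>)" "d * (\<mu> - \<kappa>)"] ab by auto
    have "moment_eigen G (A \<inter> \<Pi>) \<nu> f" if "f \<in> \<Pi>" for f
    proof (rule moment_eigen_span)
      show "f \<in> covec.span {\<alpha>, \<beta>}" using that sp by simp
    qed (use \<nu> \<mu> eq in auto)
    moreover have "A \<inter> \<Pi> \<subseteq> dual sc" "\<Pi> \<subseteq> dual sc" using A \<Pi> by (auto simp: covector_plane_def)
    ultimately show ?thesis using well_distributed_sharp_iff by blast
  qed
qed

text \<open>Every other member of \<open>A\<close> lies in exactly one plane through \<alpha> from
  the family \<open>\<P>\<close>, so M_A \<alpha> is assembled from the plane contributions. The
  term of \<alpha> itself occurs in each of them but must be counted once.\<close>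

lemma global_eigen:
  assumes A: "finite A" "A \<subseteq> dual sc" "pairwise_noncollinear A" and \<alpha>: "\<alpha> \<in> A"
    and eigen: "\<And>\<Pi>. covector_plane sc \<Pi> \<Longrightarrow> \<alpha> \<in> \<Pi> \<Longrightarrow> \<exists>\<nu>. moment_eigen G (A \<inter> \<Pi>) \<nu> \<alpha>"
  shows "\<exists>\<nu>. moment_eigen G A \<nu> \<alpha>"
proof -
  define P where "P \<beta> = covec.span {\<alpha>, \<beta>}" for \<beta>
  define \<P> where "\<P> = P ` (A - {\<alpha>})"
  have ind: "covec.independent {\<alpha>, \<beta>}" if "\<beta> \<in> A - {\<alpha>}" for \<beta>
    using A(3) that \<alpha> by (auto simp: pairwise_noncollinear_def pairwise_def)
  have plane: "covector_plane sc (P \<beta>)" if "\<beta> \<in> A - {\<alpha>}" for \<beta>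
    unfolding P_def using that A \<alpha> by (intro covector_plane_span vs ind) auto
  have \<alpha>P: "\<alpha> \<in> P \<beta>" "\<beta> \<in> P \<beta>" for \<beta>
    unfolding P_def by (auto intro: covec.span_base)
  \<comment> \<open>The fibres of \<open>P\<close> partition \<open>A - {\<alpha>}\<close>; each is
    the trace of a plane with \<alpha> removed.\<close>
  have fibre: "{\<beta> \<in> A - {\<alpha>}. P \<beta> = \<Pi>} = A \<inter> \<Pi> - {\<alpha>}" if "\<Pi> \<in> \<P>" for \<Pi>
  proof -
    have \<Pi>: "covector_plane sc \<Pi>" "\<alpha> \<in> \<Pi>" using that plane \<alpha>P unfolding \<P>_def by auto
    have "P \<beta> = \<Pi>" if "\<beta> \<in> A \<inter> \<Pi> - {\<alpha>}" for \<beta>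
      unfolding P_def using that \<Pi> by (intro plane_eq_span[OF \<Pi>(1) ind]) auto
    then show ?thesis using \<alpha>P by auto
  qed
  have "\<forall>\<Pi>\<in>\<P>. \<exists>\<nu>. moment_eigen G (A \<inter> \<Pi>) \<nu> \<alpha>"
    using plane \<alpha>P unfolding \<P>_def by (auto intro: eigen)
  then obtain \<nu> where \<nu>: "\<And>\<Pi>. \<Pi> \<in> \<P> \<Longrightarrow> moment_eigen G (A \<inter> \<Pi>) (\<nu> \<Pi>) \<alpha>" by metis
  define q where "q = \<alpha> (sharp G \<alpha>)"
  \<comment> \<open>Each plane contributes its eigenvalue less the share \<open>q\<close> of
    \<alpha>; one copy of \<open>q\<close> is restored.\<close>
  have "moment G A \<alpha> y = (q + (\<Sum>\<Pi>\<in>\<P>. \<nu> \<Pi> - q)) * \<alpha> y" for y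
  proof -
    let ?h = "\<lambda>\<beta>. \<alpha> (sharp G \<beta>) * \<beta> y"
    have "sum ?h (A \<inter> \<Pi> - {\<alpha>}) = (\<nu> \<Pi> - q) * \<alpha> y" if "\<Pi> \<in> \<P>" for \<Pi>
    proof -
      have "\<alpha> \<in> A \<inter> \<Pi>" using that \<alpha> \<alpha>P unfolding \<P>_def by auto
      then have "sum ?h (A \<inter> \<Pi>) = q * \<alpha> y + sum ?h (A \<inter> \<Pi> - {\<alpha>})"
        using A(1) by (simp add: sum.remove[of _ \<alpha>] q_def)
      then show ?thesis
        using \<nu>[OF that] by (simp add: moment_eigen_def moment_def algebra_simps)
    qed
    then have "sum ?h (A - {\<alpha>}) = (\<Sum>\<Pi>\<in>\<P>. (\<nu> \<Pi> - q) * \<alpha> y)"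
      using A(1) fibre unfolding \<P>_def by (subst sum.image_gen[of _ _ P]) auto
    moreover have "moment G A \<alpha> y = q * \<alpha> y + sum ?h (A - {\<alpha>})"
      using A(1) \<alpha> by (simp add: moment_def sum.remove[of _ \<alpha>] q_def)
    ultimately show ?thesis by (simp add: algebra_simps sum_distrib_left sum_distrib_right)
  qed
  then show ?thesis unfolding moment_eigen_def by blast
qed

text \<open>M_B is self-adjoint: pairing M_B f with g gives the sum of (f, \<beta>) (\<beta>, g),
  which is symmetric in f and g.\<close>

lemma moment_eigen_orthogonal:
  assumes B: "B \<subseteq> dual sc" and fg: "f \<in> dual sc" "g \<in> dual sc"
    and eigen: "moment_eigen G B \<nu> f" "moment_eigen G B \<mu> g" and ne: "\<nu> \<noteq> \<mu>"
  shows "f (sharp G g) = 0"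
proof -
  have "moment G B f (sharp G g) = moment G B g (sharp G f)"
    unfolding moment_def using B fg
    by (intro sum.cong refl) (auto simp: apply_sharp_commute subset_iff)
  then have "\<nu> * f (sharp G g) = \<mu> * f (sharp G g)"
    using eigen apply_sharp_commute[OF fg] by (simp add: moment_eigen_def)
  with ne show ?thesis by simp
qed

text \<open>The summands are the spans of \<open>A1\<close> and \<open>A2\<close>. A covector in
  both is orthogonal to \<open>A1\<close>, lying in the span of \<open>A2\<close>, and likewise to
  \<open>A2\<close>. It is thus orthogonal to all of \<open>A\<close> and vanishes by non-degeneracy
  on the whole space, even if \<open>G\<close> degenerates on a summand.\<close>

lemma decomposable_if_orthogonal:
  assumes A: "covec.span A = dual sc" "0 \<notin> A" "A = A1 \<union> A2" "A1 \<noteq> {}" "A2 \<noteq> {}"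
    and orth: "\<And>f g. f \<in> A1 \<Longrightarrow> g \<in> A2 \<Longrightarrow> f (sharp G g) = 0"
  shows "decomposable sc A"
proof -
  have dual: "A \<subseteq> dual sc" using A(1) covec.span_superset by blast
  have vanish: "f (sharp G g) = 0" if "f \<in> covec.span S" "\<And>f. f \<in> S \<Longrightarrow> f (sharp G g) = 0" for f g S
    using that(1)
  proof (induction rule: covec.span_induct)
    case base
    show ?case by (auto simp: covec.subspace_def fscale_def)
  qed (use that(2) in auto)
  have "f = 0" if f: "f \<in> covec.span A1" "f \<in> covec.span A2" for f
  proof -
    have fd: "f \<in> dual sc" using f(1) A covec.span_mono[of A1 A] by auto
    have "\<alpha> (sharp G f) = 0" if \<alpha>: "\<alpha> \<in> A" for \<alpha>
    proof -
      have \<alpha>d: "\<alpha> \<in> dual sc" using \<alpha> dual by blast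
      have "f (sharp G \<alpha>) = 0"
      proof (cases "\<alpha> \<in> A1")
        case True
        have "g (sharp G \<alpha>) = 0" if "g \<in> A2" for g
          using orth[OF True that] apply_sharp_commute[OF \<alpha>d] that dual A(3) by auto
        then show ?thesis using f(2) by (intro vanish[of f A2])
      next
        case False
        then show ?thesis
          using f(1) orth \<alpha> A(3) by (intro vanish[of f A1]) auto
      qed
      then show ?thesis using apply_sharp_commute[OF fd \<alpha>d] by simp
    qed
    then have "sharp G f = 0" by (rule zero_if_spanning_vanish[OF A(1)])
    then show "f = 0" using G_sharp[OF fd] by (simp add: G_left fun_eq_iff)
  qed
  then have "covec.span A1 \<inter> covec.span A2 = {0}"
    by (auto intro: covec.span_zero)
  moreover have "{f + g | f g. f \<in> covec.span A1 \<and> g \<in> covec.span A2} = dual sc"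
    using A covec.span_Un[of A1 A2] by auto
  \<comment> \<open>Here \<open>0 \<notin> A\<close> enters: a non-empty part of \<open>A\<close>
    has a non-zero span.\<close>
  moreover have "covec.span A1 \<noteq> {0}" "covec.span A2 \<noteq> {0}"
    using A covec.span_base by (metis UnCI ex_in_conv singletonD)+
  moreover have "A = (A \<inter> covec.span A1) \<union> (A \<inter> covec.span A2)"
    using A(3) covec.span_base by blast
  ultimately show ?thesis
    unfolding decomposable_def using covec.subspace_span by blast
qed

text \<open>A hyperplane is not the whole space, so its covector is non-zero. Two collinear non-zero
  covectors have the same kernel, hence come from the same hyperplane and coincide.\<close>

lemma equipment_facts:
  assumes \<Delta>: "central_arrangement sc \<Delta>" and eq: "equipment sc \<Delta> A"
  shows "finite A" "A \<subseteq> dual sc" "0 \<notin> A" "pairwise_noncollinear A"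
proof -
  obtain a where a: "A = a ` \<Delta>" "\<And>H. H \<in> \<Delta> \<Longrightarrow> a H \<in> dual sc" "\<And>H. H \<in> \<Delta> \<Longrightarrow> H = {x. a H x = 0}"
    using eq unfolding equipment_def by blast
  show "finite A" "A \<subseteq> dual sc"
    using a \<Delta> by (auto simp: central_arrangement_def)
  have nz: "a H \<noteq> 0" if "H \<in> \<Delta>" for H
  proof
    assume "a H = 0"
    then have "H = UNIV" using a(3)[OF that] by simp
    then show False using \<Delta> that by (auto simp: central_arrangement_def hyperplane_def)
  qed
  then show "0 \<notin> A" using a(1) by auto
  show "pairwise_noncollinear A"
    unfolding pairwise_noncollinear_def pairwise_def
  proof (intro ballI impI)
    fix \<alpha> \<beta> assume "\<alpha> \<in> A" "\<beta> \<in> A" and ne: "\<alpha> \<noteq> \<beta>"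
    then obtain H K where HK: "H \<in> \<Delta>" "K \<in> \<Delta>" "\<alpha> = a H" "\<beta> = a K" using a(1) by blast
    have "c = 0 \<and> d = 0" if eq: "\<forall>y. c * \<alpha> y + d * \<beta> y = 0" for c d
    proof (rule ccontr)
      assume "\<not> (c = 0 \<and> d = 0)"
      moreover have "\<exists>y. \<alpha> y \<noteq> 0" "\<exists>y. \<beta> y \<noteq> 0"
        using nz HK by (auto simp: fun_eq_iff)
      ultimately have "c \<noteq> 0" "d \<noteq> 0" using eq by auto
      then have "\<alpha> y = 0 \<longleftrightarrow> \<beta> y = 0" for y
        using eq[rule_format, of y] by (auto simp: add_eq_0_iff)
      then have "H = K" using a(3) HK by blast
      with ne HK show False by simp
    qed
    then show "covec.independent {\<alpha>, \<beta>}"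
      unfolding covec_independent_pair_iff[OF ne] by blast
  qed
qed

lemma euclidean_vee_if_representation:
  assumes \<Delta>: "central_arrangement sc \<Delta>" "irreducible_arrangement sc \<Delta>"
    and eq: "equipment sc \<Delta> A"
    and rep: "defines_representation sc A (\<lambda>\<alpha>. rank_one sc (sharp G \<alpha>) \<alpha>)"
  shows "complex_euclidean_vee_system sc G A"
proof -
  note A = equipment_facts[OF \<Delta>(1) eq]
  have span: "covec.span A = dual sc" using eq by (simp add: equipment_def)
  have eigen: "\<exists>\<nu>. moment_eigen G (A \<inter> \<Pi>) \<nu> \<alpha>" if "covector_plane sc \<Pi>" "\<alpha> \<in> A \<inter> \<Pi>" for \<alpha> \<Pi>
    using rep that representation_iff[OF A(1,2)] by blast
  have indec: "\<not> decomposable sc A"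
    using \<Delta>(2) eq unfolding irreducible_arrangement_def by blast
  have "\<forall>\<alpha>\<in>A. \<exists>\<nu>. moment_eigen G A \<nu> \<alpha>"
    using global_eigen[OF A(1,2,4)] eigen by blast
  then obtain \<nu> where \<nu>: "\<And>\<alpha>. \<alpha> \<in> A \<Longrightarrow> moment_eigen G A (\<nu> \<alpha>) \<alpha>" by metis
  \<comment> \<open>If two eigenvalues occurred, splitting \<open>A\<close> into the covectors with
    eigenvalue \<open>\<nu> \<alpha>\<close> and the rest would give two non-empty, mutually
    orthogonal parts.\<close>
  have const: "\<nu> \<alpha> = \<nu> \<beta>" if ab: "\<alpha> \<in> A" "\<beta> \<in> A" for \<alpha> \<beta>
  proof (rule ccontr)
    assume ne: "\<nu> \<alpha> \<noteq> \<nu> \<beta>"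
    have "decomposable sc A"
    proof (rule decomposable_if_orthogonal[OF span A(3)])
      show "A = {\<gamma> \<in> A. \<nu> \<gamma> = \<nu> \<alpha>} \<union> {\<gamma> \<in> A. \<nu> \<gamma> \<noteq> \<nu> \<alpha>}" by blast
      show "f (sharp G g) = 0" if "f \<in> {\<gamma> \<in> A. \<nu> \<gamma> = \<nu> \<alpha>}" "g \<in> {\<gamma> \<in> A. \<nu> \<gamma> \<noteq> \<nu> \<alpha>}" for f g
        using that A(2) by (intro moment_eigen_orthogonal[OF A(2) _ _ \<nu> \<nu>]) auto
    qed (use ab ne in auto)
    with indec show False ..
  qed
  have "\<exists>\<kappa>. \<forall>\<alpha>\<in>A. moment_eigen G A \<kappa> \<alpha>"
    using const \<nu> by (metis (full_types))
  \<comment> \<open>\<open>A\<close> spans the dual, so a common eigenvalue makes M_A scalar, which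
    is global well-distributedness.\<close>
  then have "\<exists>\<kappa>. \<forall>f\<in>dual sc. moment_eigen G A \<kappa> f"
    using moment_eigen_span[of A] span by blast
  then have "well_distributed G UNIV A"
    using well_distributed_sharp_iff[OF A(2) order_refl] by (simp add: sharp_image_dual)
  moreover have "reducible_pair G (A \<inter> \<Pi>) \<or> well_distributed G (sharp G ` \<Pi>) (A \<inter> \<Pi>)"
    if "covector_plane sc \<Pi>" "covec.span (A \<inter> \<Pi>) = \<Pi>" for \<Pi>
    using plane_alternative[OF A(1,2,4) that] eigen[OF that(1)] by blast
  ultimately show ?thesis
    unfolding complex_euclidean_vee_system_def using A by blast
qed

end

section \<open>Vee-systems and the theorem\<close>

lemma complex_euclidean_canonical_form:
  assumes "vector_space sc" "A \<subseteq> dual sc" "nondegenerate (canonical_form A)"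
  shows "complex_euclidean sc (canonical_form A)"
proof -
  have "canonical_form A x \<in> dual sc" for x
    unfolding dual_iff[OF assms(1)] canonical_form_def
    using assms(2) by (auto simp: mem_dual subset_iff ring_distribs sum.distrib sum_distrib_left
        mult.left_commute intro!: sum.cong simp flip: sum.distrib)
  moreover have "canonical_form A x y = canonical_form A y x" for x y
    by (simp add: canonical_form_def mult.commute)
  ultimately show ?thesis
    using assms(3) by (simp add: complex_euclidean_def)
qed

lemma representation_if_vee:
  assumes fd: "finite_dimensional_vector_space sc basis" and vee: "vee_system sc A"
  shows "defines_representation sc A (\<lambda>\<alpha>. rank_one sc (sharp (canonical_form A) \<alpha>) \<alpha>)"
proof -
  have A: "finite A" "A \<subseteq> dual sc" "nondegenerate (canonical_form A)"
    and sums: "\<And>\<alpha> \<Pi>. covector_plane sc \<Pi> \<Longrightarrow> \<alpha> \<in> A \<inter> \<Pi> \<Longrightarrow>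
      \<exists>\<nu>. (\<Sum>\<beta>\<in>A \<inter> \<Pi>. sc (\<beta> (sharp (canonical_form A) \<alpha>)) (sharp (canonical_form A) \<beta>))
             = sc \<nu> (sharp (canonical_form A) \<alpha>)"
    using vee unfolding vee_system_def Int_commute[of _ A] by blast+
  have vs: "vector_space sc"
    using fd by (simp add: finite_dimensional_vector_space_def)
  \<comment> \<open>The canonical form itself serves as the Euclidean form, so \<open>sharp\<close>
    becomes the map from \<alpha> to its dual vector in the vee-system.\<close>
  interpret complex_euclidean_space sc basis "canonical_form A"
    by (rule complex_euclidean_space.intro[OF fd complex_euclidean_space_axioms.intro])
      (rule complex_euclidean_canonical_form[OF vs A(2,3)])
  have "\<exists>\<nu>. moment_eigen (canonical_form A) (A \<inter> \<Pi>) \<nu> \<alpha>"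
    if "covector_plane sc \<Pi>" "\<alpha> \<in> A \<inter> \<Pi>" for \<alpha> \<Pi>
    using sums[OF that] vee_sum_iff_eigen[of "A \<inter> \<Pi>" \<alpha>] A(2) that(2) by blast
  then show ?thesis using representation_iff[OF A(1,2)] by blast
qed

theorem theorem1:
  fixes sc :: "complex \<Rightarrow> 'v::ab_group_add \<Rightarrow> 'v" and basis :: "'v set"
  assumes "finite_dimensional_vector_space sc basis"
  shows
    "(\<forall>A. vee_system sc A \<longrightarrow>
        defines_representation sc A (\<lambda>\<alpha>. rank_one sc (sharp (canonical_form A) \<alpha>) \<alpha>)) \<and>
     (\<forall>G A. complex_euclidean sc G \<and> complex_euclidean_vee_system sc G A \<longrightarrow>
        defines_representation sc A (\<lambda>\<alpha>. rank_one sc (sharp G \<alpha>) \<alpha>)) \<and>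
     (\<forall>G \<Delta> A. complex_euclidean sc G \<and> central_arrangement sc \<Delta> \<and>
        irreducible_arrangement sc \<Delta> \<and> equipment sc \<Delta> A \<and>
        defines_representation sc A (\<lambda>\<alpha>. rank_one sc (sharp G \<alpha>) \<alpha>) \<longrightarrow>
        complex_euclidean_vee_system sc G A)"
proof (intro conjI allI impI; (elim conjE)?)
  note space = complex_euclidean_space.intro[OF assms complex_euclidean_space_axioms.intro]
  show "defines_representation sc A (\<lambda>\<alpha>. rank_one sc (sharp (canonical_form A) \<alpha>) \<alpha>)"
    if "vee_system sc A" for A
    using that by (rule representation_if_vee[OF assms])
  show "defines_representation sc A (\<lambda>\<alpha>. rank_one sc (sharp G \<alpha>) \<alpha>)"
    if "complex_euclidean sc G" "complex_euclidean_vee_system sc G A" for G A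
    using complex_euclidean_space.representation_if_euclidean_vee[OF space] that by blast
  show "complex_euclidean_vee_system sc G A"
    if "complex_euclidean sc G" "central_arrangement sc \<Delta>" "irreducible_arrangement sc \<Delta>"
      "equipment sc \<Delta> A" "defines_representation sc A (\<lambda>\<alpha>. rank_one sc (sharp G \<alpha>) \<alpha>)"
    for G \<Delta> A
    using complex_euclidean_space.euclidean_vee_if_representation[OF space] that by blast
qed

end
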